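(* Assume (A1), (A2), (A3) of the context. For every $u\in\mathcal H_{\mathrm{ad}}$ and every bounded perturbation $v\in\mathcal H_{\mathrm{ad}}$, $$DJ(u)v=\mathbb E\Bigl[h\sum_{n=0}^{N-1}\langle\widehat g_n,v_n\rangle\Bigr],$$ where $\widehat g_n$ is the samplewise gradient density at $u$ defined in the context. For deterministic parameter sequences $u\in\mathcal H_{\mathrm{det}}$ this implies $$\mathbb E[\widehat g(u)]=\nabla J(u)\quad\text{in }\mathcal H_{\mathrm{det}}.$$
   Context: Noise. Fix $H\in(0,1)$, an integer $N\ge1$, a step size $h>0$, $T=Nh$, $t_n=nh$, and a scalar fractional Brownian motion $B^H$ of Hurst exponent $H$ on a complete probability space $(\Omega,\mathcal F,\mathbb P)$. For $0\le n<N$ put $\xi_n^H=h^{-H}(B^H_{t_{n+1}}-B^H_{t_n})$; these are centred Gaussian with covariance $\rho(i,j)=\tfrac12(|i-j+1|^{2H}+|i-j-1|^{2H}-2|i-j|^{2H})$. The covariance matrix $\Sigma_N=[\rho(i,j)]_{0\le i,j<N}$ is strictly positive definite; $\beta=(\beta(n,k))_{0\le k\le n<N}$ is its unique lower triangular Cholesky factor with $\beta(n,n)>0$, and $\gamma=\beta^{-1}$. Set $\eta_n=\sum_{k=0}^n\gamma(n,k)\xi_k^H$ (i.i.d. standard normal), so $\xi_n^H=\sum_{k=0}^n\beta(n,k)\eta_k$. Let $\mathcal F_n=\sigma(\eta_0,\dots,\eta_{n-1})$, $\mathcal F_0=\{\emptyset,\Omega\}$. State equation. Let $x_0\in\mathbb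 R^d$ and $b,\sigma:\{0,\dots,N-1\}\times\mathbb R^d\times\mathbb R^p\to\mathbb R^d$ be deterministic. For a control $u=(u_n)$, $X=X^u$ solves $X_{n+1}=X_n+h\,b(n,X_n,u_n)+\sqrt h\,\sigma(n,X_n,u_n)\xi_n^H$, $X_0=x_0$, $0\le n\le N-1$. Cost. $J(u)=\mathbb E\bigl[\Phi(X_N^u)+h\sum_{n=0}^{N-1}\ell(n,X_n^u,u_n)\bigr]$ with $\Phi:\mathbb R^d\to\mathbb R$, $\ell:\{0,\dots,N-1\}\times\mathbb R^d\times\mathbb R^p\to\mathbb R$. Assumptions. (A1) $b,\sigma,\Phi,\ell$ are twice continuously differentiable in $(x,u)$ and their partial derivatives up to order two are bounded by a constant $L>0$ and globally Lipschitz in $(x,u)$, uniformly in $n$. (A2) There is $L'>0$ with $\|b(n,x,u)\|\le L'(1+\|x\|+\|u\|)$ and $\|\sigma(n,x,u)\|\le L'$ for all $(n,x,u)$. (A3) $\mathcal U\subset\mathbb R^p$ is a closed convex set containing the origin; $\mathcal H_{\mathrm{ad}}$ is the Hilbert space of sequences $u=(u_n)_{n=0}^{N-1}$ with $u_n\in L^2(\Omega,\mathcal F_n;\mathbb R^p)$ and norm $\|u\|^2_{\mathcal H_{\mathrm{ad}}}=h\sum_{n=0}^{N-1}\mathbb E\|u_n\|^2$; the admissible set is $\mathcal U_{\mathrm{ad}}=\{u\in\mathcal H_{\mathrm{ad}}:u_n\in\mathcal U\text{ a.s. for every }n\}$. Deterministic parameters. $\mathcal H_{\mathrm{det}}=(\mathbb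 R^p)^N$ with $\|u\|^2_{\mathcal H_{\mathrm{det}}}=h\sum_{n=0}^{N-1}\|u_n\|^2$ and the corresponding inner product $\langle u,v\rangle_{\mathcal H_{\mathrm{det}}}=h\sum_n\langle u_n,v_n\rangle$. For $u\in\mathcal H_{\mathrm{det}}$, $\nabla J(u)\in\mathcal H_{\mathrm{det}}$ is the gradient (Riesz representative) of $J$ restricted to $\mathcal H_{\mathrm{det}}$ with respect to this inner product. Samplewise gradient. With $A_n=I_d+h\,b_x(n,X_n,u_n)$, $B_n=\sqrt h\,\sigma_x(n,X_n,u_n)$, $\Lambda_n=\ell_x(n,X_n,u_n)$, define pathwise (for each noise realisation) $$\widehat p_N=\Phi_x(X_N),\qquad \widehat p_n=A_n^*\widehat p_{n+1}+B_n^*\widehat p_{n+1}\xi_n^H+h\Lambda_n,\quad n=N-1,\dots,0,$$ $$\widehat g_n=b_u(n,X_n,u_n)^*\widehat p_{n+1}+\ell_u(n,X_n,u_n)+h^{-1/2}\sigma_u(n,X_n,u_n)^*\widehat p_{n+1}\xi_n^H,$$ and $\widehat g(u)=(\widehat g_n)_{n=0}^{N-1}$. Subscripts $x,u$ denote partial derivatives, $^*$ the transpose, and $DJ(u)v$ is the directional derivative of $J$ at $u$ in direction $v$. *)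

theory Defs
  imports "HOL-Probability.Probability"
begin

section \<open>Noise\<close>

text \<open>Degenerate (almost surely constant) variables count as Gaussian, as they must for the
  linear combinations of a Gaussian process.\<close>

definition gaussian_rv :: "'w measure \<Rightarrow> ('w \<Rightarrow> real) \<Rightarrow> bool" where
  "gaussian_rv M Y \<longleftrightarrow> Y \<in> borel_measurable M \<and>
     (\<exists>\<mu> s. (s = 0 \<and> (AE \<omega> in M. Y \<omega> = \<mu>)) \<or>
            (s > 0 \<and> distributed M lborel Y (\<lambda>y. ennreal (normal_density \<mu> s y))))"

definition gaussian_process :: "'w measure \<Rightarrow> 'i set \<Rightarrow> ('i \<Rightarrow> 'w \<Rightarrow> real) \<Rightarrow> bool" where
  "gaussian_process M T Y \<longleftrightarrow>
     (\<forall>I c. finite I \<and> I \<subseteq> T \<longrightarrow> gaussian_rv M (\<lambda>\<omega>. \<Sum>t\<in>I. c t * Y t \<omega>))"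

definition fractional_brownian_motion :: "'w measure \<Rightarrow> real \<Rightarrow> (real \<Rightarrow> 'w \<Rightarrow> real) \<Rightarrow> bool" where
  "fractional_brownian_motion M H B \<longleftrightarrow>
     gaussian_process M {0..} B \<and>
     (\<forall>t\<ge>0. integral\<^sup>L M (B t) = 0) \<and>
     (\<forall>s\<ge>0. \<forall>t\<ge>0. integral\<^sup>L M (\<lambda>\<omega>. B s \<omega> * B t \<omega>) =
        (s powr (2 * H) + t powr (2 * H) - \<bar>t - s\<bar> powr (2 * H)) / 2)"

definition fgn :: "real \<Rightarrow> real \<Rightarrow> (real \<Rightarrow> 'w \<Rightarrow> real) \<Rightarrow> nat \<Rightarrow> 'w \<Rightarrow> real" where
  "fgn H h B n \<omega> = h powr (- H) * (B (real (Suc n) * h) \<omega> - B (real n * h) \<omega>)"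

definition fgn_cov :: "real \<Rightarrow> nat \<Rightarrow> nat \<Rightarrow> real" where
  "fgn_cov H i j =
     (\<bar>real i - real j + 1\<bar> powr (2 * H) + \<bar>real i - real j - 1\<bar> powr (2 * H)
       - 2 * \<bar>real i - real j\<bar> powr (2 * H)) / 2"

text \<open>An \<open>N \<times> N\<close> matrix is a function of two indices, of which only the values at indices
  below \<open>N\<close> matter.\<close>

definition cholesky_factor ::
  "nat \<Rightarrow> (nat \<Rightarrow> nat \<Rightarrow> real) \<Rightarrow> (nat \<Rightarrow> nat \<Rightarrow> real) \<Rightarrow> bool" where
  "cholesky_factor N S \<beta> \<longleftrightarrow>
     (\<forall>i<N. \<forall>j<N. i < j \<longrightarrow> \<beta> i j = 0) \<and>
     (\<forall>i<N. \<beta> i i > 0) \<and>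
     (\<forall>i<N. \<forall>j<N. (\<Sum>k<N. \<beta> i k * \<beta> j k) = S i j)"

definition inverse_matrix ::
  "nat \<Rightarrow> (nat \<Rightarrow> nat \<Rightarrow> real) \<Rightarrow> (nat \<Rightarrow> nat \<Rightarrow> real) \<Rightarrow> bool" where
  "inverse_matrix N A A' \<longleftrightarrow>
     (\<forall>i<N. \<forall>j<N. (\<Sum>k<N. A i k * A' k j) = (if i = j then 1 else 0) \<and>
                  (\<Sum>k<N. A' i k * A k j) = (if i = j then 1 else 0))"

definition innovation ::
  "(nat \<Rightarrow> nat \<Rightarrow> real) \<Rightarrow> (nat \<Rightarrow> 'w \<Rightarrow> real) \<Rightarrow> nat \<Rightarrow> 'w \<Rightarrow> real" where
  "innovation \<gamma> \<xi> n \<omega> = (\<Sum>k\<le>n. \<gamma> n k * \<xi> k \<omega>)"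

definition innovation_filtration ::
  "'w measure \<Rightarrow> (nat \<Rightarrow> 'w \<Rightarrow> real) \<Rightarrow> nat \<Rightarrow> 'w measure" where
  "innovation_filtration M \<eta> n =
     sigma (space M) {\<eta> k -` A \<inter> space M | k A. k < n \<and> A \<in> sets borel}"


section \<open>Controls\<close>

text \<open>A control sequence is a function on all of \<open>nat\<close>; its values at indices \<open>n \<ge> N\<close> are
  never used.\<close>

definition H_ad ::
  "'w measure \<Rightarrow> (nat \<Rightarrow> 'w measure) \<Rightarrow> nat \<Rightarrow> (nat \<Rightarrow> 'w \<Rightarrow> 'c::euclidean_space) set" where
  "H_ad M F N =
     {u. \<forall>n<N. u n \<in> borel_measurable (F n) \<and> integrable M (\<lambda>\<omega>. (norm (u n \<omega>))\<^sup>2)}"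

definition bounded_control ::
  "'w measure \<Rightarrow> nat \<Rightarrow> (nat \<Rightarrow> 'w \<Rightarrow> 'c::euclidean_space) \<Rightarrow> bool" where
  "bounded_control M N v \<longleftrightarrow> (\<exists>C. \<forall>n<N. AE \<omega> in M. norm (v n \<omega>) \<le> C)"

definition hdet_inner ::
  "real \<Rightarrow> nat \<Rightarrow> (nat \<Rightarrow> 'c::euclidean_space) \<Rightarrow> (nat \<Rightarrow> 'c) \<Rightarrow> real" where
  "hdet_inner h N u v = h * (\<Sum>n<N. u n \<bullet> v n)"

definition hdet_norm :: "real \<Rightarrow> nat \<Rightarrow> (nat \<Rightarrow> 'c::euclidean_space) \<Rightarrow> real" where
  "hdet_norm h N u = sqrt (hdet_inner h N u u)"

text \<open>The analogue of \<open>GDERIV\<close> in \<open>(\<real>\<^sup>p)\<^sup>N\<close> with the weighted inner product: \<open>f\<close> is Frechet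
  differentiable at \<open>u\<close> and \<open>g\<close> is the Riesz representative of its derivative.\<close>

definition has_hdet_gradient ::
  "real \<Rightarrow> nat \<Rightarrow> ((nat \<Rightarrow> 'c::euclidean_space) \<Rightarrow> real) \<Rightarrow> (nat \<Rightarrow> 'c) \<Rightarrow> (nat \<Rightarrow> 'c) \<Rightarrow> bool" where
  "has_hdet_gradient h N f u g \<longleftrightarrow>
     (\<forall>e>0. \<exists>d>0. \<forall>v. hdet_norm h N v < d \<longrightarrow>
        \<bar>f (\<lambda>n. u n + v n) - f u - hdet_inner h N g v\<bar> \<le> e * hdet_norm h N v)"

lemma hdet_inner_scale: "hdet_inner h N g (\<lambda>n. t *\<^sub>R v n) = t * hdet_inner h N g v"
  by (simp add: hdet_inner_def sum_distrib_left algebra_simps)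

lemma has_hdet_gradient_unique:
  assumes "h > 0" and g: "has_hdet_gradient h N f u g" and g': "has_hdet_gradient h N f u g'"
    and "n < N"
  shows "g n = g' n"
proof -
  define w where "w = (\<lambda>n. g n - g' n)"
  define r where "r = hdet_norm h N w"
  have ww0: "hdet_inner h N w w \<ge> 0"
    using \<open>h > 0\<close> by (auto simp: hdet_inner_def intro!: mult_nonneg_nonneg sum_nonneg)
  have ww: "hdet_inner h N w w = r\<^sup>2" and "r \<ge> 0"
    using ww0 by (auto simp: r_def hdet_norm_def)
  have wdiff: "hdet_inner h N w v = hdet_inner h N g v - hdet_inner h N g' v" for v
    by (simp add: hdet_inner_def w_def inner_diff_left sum_subtractf right_diff_distrib)
  have norm_scale: "hdet_norm h N (\<lambda>n. t *\<^sub>R w n) = t * r" if "t > 0" for t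
  proof -
    have "hdet_inner h N (\<lambda>n. t *\<^sub>R w n) (\<lambda>n. t *\<^sub>R w n) = t\<^sup>2 * hdet_inner h N w w"
      by (simp add: hdet_inner_def sum_distrib_left power2_eq_square algebra_simps)
    also have "\<dots> = (t * r)\<^sup>2"
      by (simp add: ww power_mult_distrib)
    finally have "hdet_inner h N (\<lambda>n. t *\<^sub>R w n) (\<lambda>n. t *\<^sub>R w n) = (t * r)\<^sup>2" .
    then show ?thesis using that \<open>r \<ge> 0\<close> by (simp add: hdet_norm_def)
  qed
  have "r = 0"
  proof (rule ccontr)
    assume "r \<noteq> 0"
    then have "r > 0" using \<open>r \<ge> 0\<close> by simp
    define e where "e = r / 4"
    have "e > 0" using \<open>r > 0\<close> by (simp add: e_def)
    obtain d where d: "d > 0" "\<And>v. hdet_norm h N v < d \<Longrightarrow>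
        \<bar>f (\<lambda>n. u n + v n) - f u - hdet_inner h N g v\<bar> \<le> e * hdet_norm h N v"
      using g \<open>e > 0\<close> unfolding has_hdet_gradient_def by meson
    obtain d' where d': "d' > 0" "\<And>v. hdet_norm h N v < d' \<Longrightarrow>
        \<bar>f (\<lambda>n. u n + v n) - f u - hdet_inner h N g' v\<bar> \<le> e * hdet_norm h N v"
      using g' \<open>e > 0\<close> unfolding has_hdet_gradient_def by meson
    define t where "t = min d d' / (2 * r)"
    have t: "t > 0" using d(1) d'(1) \<open>r > 0\<close> by (simp add: t_def)
    have "t * r = min d d' / 2" using \<open>r > 0\<close> by (simp add: t_def)
    then have lt: "t * r < d" "t * r < d'" using d(1) d'(1) by linarith+
    let ?v = "\<lambda>n. t *\<^sub>R w n"
    have "\<bar>f (\<lambda>n. u n + ?v n) - f u - hdet_inner h N g ?v\<bar> \<le> e * (t * r)"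
      "\<bar>f (\<lambda>n. u n + ?v n) - f u - hdet_inner h N g' ?v\<bar> \<le> e * (t * r)"
      using d(2)[of ?v] d'(2)[of ?v] norm_scale[OF t] lt by simp_all
    then have "hdet_inner h N w ?v \<le> 2 * (e * (t * r))"
      unfolding wdiff by linarith
    then have "t * r\<^sup>2 \<le> t * r\<^sup>2 / 2"
      by (simp add: hdet_inner_scale ww e_def power2_eq_square algebra_simps)
    moreover have "t * r\<^sup>2 > 0" using t \<open>r > 0\<close> by simp
    ultimately show False by linarith
  qed
  then have "(\<Sum>n<N. w n \<bullet> w n) = 0"
    using ww \<open>h > 0\<close> by (simp add: hdet_inner_def)
  then have "w n \<bullet> w n = 0"
    using \<open>n < N\<close> by (subst (asm) sum_nonneg_eq_0_iff) auto
  then show ?thesis by (simp add: w_def)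
qed


section \<open>Coefficients\<close>

text \<open>\<open>f\<close> is twice continuously differentiable, its partial derivatives of order one and two with
  respect to the coordinates of \<open>'z\<close> are bounded by \<open>L\<close> and globally Lipschitz with constant
  \<open>K\<close>. No bound on \<open>f\<close> itself is imposed.\<close>

definition C2_bounded_lipschitz ::
  "real \<Rightarrow> real \<Rightarrow> ('z::euclidean_space \<Rightarrow> 'y::euclidean_space) \<Rightarrow> bool" where
  "C2_bounded_lipschitz L K f \<longleftrightarrow>
     (\<exists>(D :: 'z \<Rightarrow> 'z \<Rightarrow>\<^sub>L 'y) (D2 :: 'z \<Rightarrow> 'z \<Rightarrow>\<^sub>L ('z \<Rightarrow>\<^sub>L 'y)).
        (\<forall>z. (f has_derivative blinfun_apply (D z)) (at z)) \<and>
        (\<forall>z. (D has_derivative blinfun_apply (D2 z)) (at z)) \<and>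
        continuous_on UNIV D2 \<and>
        (\<forall>i\<in>Basis. (\<forall>z. norm (blinfun_apply (D z) i) \<le> L) \<and>
                   K-lipschitz_on UNIV (\<lambda>z. blinfun_apply (D z) i)) \<and>
        (\<forall>i\<in>Basis. \<forall>j\<in>Basis.
           (\<forall>z. norm (blinfun_apply (blinfun_apply (D2 z) i) j) \<le> L) \<and>
           K-lipschitz_on UNIV (\<lambda>z. blinfun_apply (blinfun_apply (D2 z) i) j)))"

definition gradient :: "('z::euclidean_space \<Rightarrow> real) \<Rightarrow> 'z \<Rightarrow> 'z" where
  "gradient f z = (THE g. GDERIV f z :> g)"


section \<open>State, cost and samplewise gradient\<close>

text \<open>Below \<open>z :: nat \<Rightarrow> real\<close> is one realisation of the noise, \<open>w\<close> one realisation of the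
  control and \<open>X\<close> one trajectory of the state.\<close>

primrec state ::
  "real \<Rightarrow> (nat \<Rightarrow> 'x::euclidean_space \<Rightarrow> 'c::euclidean_space \<Rightarrow> 'x) \<Rightarrow> (nat \<Rightarrow> 'x \<Rightarrow> 'c \<Rightarrow> 'x) \<Rightarrow>
   'x \<Rightarrow> (nat \<Rightarrow> real) \<Rightarrow> (nat \<Rightarrow> 'c) \<Rightarrow> nat \<Rightarrow> 'x" where
  "state h b \<sigma> x0 z w 0 = x0"
| "state h b \<sigma> x0 z w (Suc n) =
     state h b \<sigma> x0 z w n
       + h *\<^sub>R b n (state h b \<sigma> x0 z w n) (w n)
       + (sqrt h * z n) *\<^sub>R \<sigma> n (state h b \<sigma> x0 z w n) (w n)"

definition path_cost ::
  "nat \<Rightarrow> real \<Rightarrow> (nat \<Rightarrow> 'x::euclidean_space \<Rightarrow> 'c::euclidean_space \<Rightarrow> 'x) \<Rightarrow>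
   (nat \<Rightarrow> 'x \<Rightarrow> 'c \<Rightarrow> 'x) \<Rightarrow> ('x \<Rightarrow> real) \<Rightarrow> (nat \<Rightarrow> 'x \<Rightarrow> 'c \<Rightarrow> real) \<Rightarrow> 'x \<Rightarrow>
   (nat \<Rightarrow> real) \<Rightarrow> (nat \<Rightarrow> 'c) \<Rightarrow> real" where
  "path_cost N h b \<sigma> \<Phi> l x0 z w =
     \<Phi> (state h b \<sigma> x0 z w N) + h * (\<Sum>n<N. l n (state h b \<sigma> x0 z w n) (w n))"

definition cost ::
  "'w measure \<Rightarrow> (nat \<Rightarrow> 'w \<Rightarrow> real) \<Rightarrow>
   nat \<Rightarrow> real \<Rightarrow> (nat \<Rightarrow> 'x::euclidean_space \<Rightarrow> 'c::euclidean_space \<Rightarrow> 'x) \<Rightarrow>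
   (nat \<Rightarrow> 'x \<Rightarrow> 'c \<Rightarrow> 'x) \<Rightarrow> ('x \<Rightarrow> real) \<Rightarrow> (nat \<Rightarrow> 'x \<Rightarrow> 'c \<Rightarrow> real) \<Rightarrow> 'x \<Rightarrow>
   (nat \<Rightarrow> 'w \<Rightarrow> 'c) \<Rightarrow> real" where
  "cost M \<xi> N h b \<sigma> \<Phi> l x0 u =
     integral\<^sup>L M (\<lambda>\<omega>. path_cost N h b \<sigma> \<Phi> l x0 (\<lambda>n. \<xi> n \<omega>) (\<lambda>n. u n \<omega>))"

definition lin_A ::
  "real \<Rightarrow> (nat \<Rightarrow> 'x::euclidean_space \<Rightarrow> 'c::euclidean_space \<Rightarrow> 'x) \<Rightarrow>
   (nat \<Rightarrow> 'x) \<Rightarrow> (nat \<Rightarrow> 'c) \<Rightarrow> nat \<Rightarrow> 'x \<Rightarrow> 'x" where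
  "lin_A h b X w n = (\<lambda>y. y + h *\<^sub>R frechet_derivative (\<lambda>x. b n x (w n)) (at (X n)) y)"

definition lin_B ::
  "real \<Rightarrow> (nat \<Rightarrow> 'x::euclidean_space \<Rightarrow> 'c::euclidean_space \<Rightarrow> 'x) \<Rightarrow>
   (nat \<Rightarrow> 'x) \<Rightarrow> (nat \<Rightarrow> 'c) \<Rightarrow> nat \<Rightarrow> 'x \<Rightarrow> 'x" where
  "lin_B h \<sigma> X w n = (\<lambda>y. sqrt h *\<^sub>R frechet_derivative (\<lambda>x. \<sigma> n x (w n)) (at (X n)) y)"

definition lin_Lambda ::
  "(nat \<Rightarrow> 'x::euclidean_space \<Rightarrow> 'c::euclidean_space \<Rightarrow> real) \<Rightarrow>
   (nat \<Rightarrow> 'x) \<Rightarrow> (nat \<Rightarrow> 'c) \<Rightarrow> nat \<Rightarrow> 'x" where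
  "lin_Lambda l X w n = gradient (\<lambda>x. l n x (w n)) (X n)"

text \<open>Backward recursion from \<open>n = N\<close>; indices above \<open>N\<close> only serve totality.\<close>

function costate ::
  "nat \<Rightarrow> real \<Rightarrow> (nat \<Rightarrow> 'x::euclidean_space \<Rightarrow> 'c::euclidean_space \<Rightarrow> 'x) \<Rightarrow>
   (nat \<Rightarrow> 'x \<Rightarrow> 'c \<Rightarrow> 'x) \<Rightarrow> ('x \<Rightarrow> real) \<Rightarrow> (nat \<Rightarrow> 'x \<Rightarrow> 'c \<Rightarrow> real) \<Rightarrow>
   (nat \<Rightarrow> 'x) \<Rightarrow> (nat \<Rightarrow> real) \<Rightarrow> (nat \<Rightarrow> 'c) \<Rightarrow> nat \<Rightarrow> 'x" where
  "costate N h b \<sigma> \<Phi> l X z w n =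
     (if n \<ge> N then gradient \<Phi> (X N)
      else adjoint (lin_A h b X w n) (costate N h b \<sigma> \<Phi> l X z w (Suc n))
         + z n *\<^sub>R adjoint (lin_B h \<sigma> X w n) (costate N h b \<sigma> \<Phi> l X z w (Suc n))
         + h *\<^sub>R lin_Lambda l X w n)"
  by pat_completeness auto
termination
  by (relation "Wellfounded.measure (\<lambda>(N, h, b, \<sigma>, \<Phi>, l, X, z, w, n). N - n)") auto

declare costate.simps [simp del]

definition path_gradient ::
  "nat \<Rightarrow> real \<Rightarrow> (nat \<Rightarrow> 'x::euclidean_space \<Rightarrow> 'c::euclidean_space \<Rightarrow> 'x) \<Rightarrow>
   (nat \<Rightarrow> 'x \<Rightarrow> 'c \<Rightarrow> 'x) \<Rightarrow> ('x \<Rightarrow> real) \<Rightarrow> (nat \<Rightarrow> 'x \<Rightarrow> 'c \<Rightarrow> real) \<Rightarrow>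
   (nat \<Rightarrow> 'x) \<Rightarrow> (nat \<Rightarrow> real) \<Rightarrow> (nat \<Rightarrow> 'c) \<Rightarrow> nat \<Rightarrow> 'c" where
  "path_gradient N h b \<sigma> \<Phi> l X z w n =
     adjoint (frechet_derivative (\<lambda>c. b n (X n) c) (at (w n))) (costate N h b \<sigma> \<Phi> l X z w (Suc n))
     + gradient (\<lambda>c. l n (X n) c) (w n)
     + (h powr (- 1 / 2) * z n) *\<^sub>R
         adjoint (frechet_derivative (\<lambda>c. \<sigma> n (X n) c) (at (w n)))
           (costate N h b \<sigma> \<Phi> l X z w (Suc n))"

definition sample_gradient ::
  "(nat \<Rightarrow> 'w \<Rightarrow> real) \<Rightarrow> nat \<Rightarrow> real \<Rightarrow>
   (nat \<Rightarrow> 'x::euclidean_space \<Rightarrow> 'c::euclidean_space \<Rightarrow> 'x) \<Rightarrow> (nat \<Rightarrow> 'x \<Rightarrow> 'c \<Rightarrow> 'x) \<Rightarrow>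
   ('x \<Rightarrow> real) \<Rightarrow> (nat \<Rightarrow> 'x \<Rightarrow> 'c \<Rightarrow> real) \<Rightarrow> 'x \<Rightarrow> (nat \<Rightarrow> 'w \<Rightarrow> 'c) \<Rightarrow> nat \<Rightarrow> 'w \<Rightarrow> 'c" where
  "sample_gradient \<xi> N h b \<sigma> \<Phi> l x0 u n \<omega> =
     path_gradient N h b \<sigma> \<Phi> l (state h b \<sigma> x0 (\<lambda>k. \<xi> k \<omega>) (\<lambda>k. u k \<omega>))
       (\<lambda>k. \<xi> k \<omega>) (\<lambda>k. u k \<omega>) n"

end

theory Submission
  imports Defs
begin

text \<open>Along a fixed noise realisation, pair the increment \<open>\<Delta>\<^sub>n\<close> of the state caused by \<open>v\<close> with
  the costate \<open>p\<^sub>n\<close>. By the adjoint recursion \<open>p\<^sub>n\<^sub>+\<^sub>1 \<bullet> \<Delta>\<^sub>n\<^sub>+\<^sub>1 - p\<^sub>n \<bullet> \<Delta>\<^sub>n\<close> equals the first-order part of the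
  change in cost at step \<open>n\<close> up to Taylor remainders, so telescoping shows that the path cost
  changes by \<open>h \<Sum> g\<^sub>n \<bullet> v\<^sub>n\<close> up to \<open>Q (\<Sum> \<parallel>v\<^sub>n\<parallel>)\<^sup>2\<close>. The factor \<open>Q\<close> is polynomial in the noise and independent of
  the control, hence integrable by finiteness of Gaussian moments. Taking expectations turns this
  into a quadratic expansion of \<open>J\<close>, which contains both the directional derivative for bounded
  \<open>v\<close> and the Frechet derivative on deterministic controls.\<close>

section \<open>Functions with bounded Lipschitz derivative\<close>

text \<open>Keeps what the cost expansion uses: a globally bounded derivative and a quadratic
  first-order Taylor remainder, under one constant. \<open>f\<close> itself is not bounded, so
  linear growth remains possible.\<close>

definition C11 :: "real \<Rightarrow> ('z::real_normed_vector \<Rightarrow> 'y::real_normed_vector) \<Rightarrow> bool" where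
  "C11 C f \<longleftrightarrow> 0 \<le> C \<and>
     (\<exists>D. \<forall>z. (f has_derivative D z) (at z) \<and>
        (\<forall>y. norm (D z y) \<le> C * norm y) \<and>
        (\<forall>y. norm (f (z + y) - f z - D z y) \<le> C * (norm y)\<^sup>2))"

text \<open>\<open>C2_bounded_lipschitz\<close> controls derivatives along coordinates only.
  Expanding \<open>y\<close> in the basis, with each coordinate at most \<open>norm y\<close> in
  size, gives an operator bound at the price of a factor \<open>DIM('z)\<close>.\<close>

lemma norm_linear_le_Basis:
  fixes A :: "'z::euclidean_space \<Rightarrow> 'y::real_normed_vector" and B :: real
  assumes "linear A" and A: "\<And>i. i \<in> Basis \<Longrightarrow> norm (A i) \<le> B"
  shows "norm (A y) \<le> DIM('z) * B * norm y"
proof -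
  have B: "0 \<le> B"
    using A[OF SOME_Basis] norm_ge_zero order_trans by blast
  have "A y = A (\<Sum>i\<in>Basis. (y \<bullet> i) *\<^sub>R i)"
    by (simp add: euclidean_representation)
  also have "\<dots> = (\<Sum>i\<in>Basis. (y \<bullet> i) *\<^sub>R A i)"
    using \<open>linear A\<close> by (simp add: linear_sum linear_scale)
  finally have "norm (A y) \<le> (\<Sum>i\<in>Basis. norm ((y \<bullet> i) *\<^sub>R A i))"
    by (simp only: norm_sum)
  also have "\<dots> \<le> (\<Sum>i\<in>(Basis::'z set). norm y * B)"
    by (intro sum_mono) (auto simp: A B Basis_le_norm intro!: mult_mono)
  finally show ?thesis by (simp add: algebra_simps)
qed

text \<open>Coordinate bounds on \<open>D\<close> become operator bounds by
  \<open>norm_linear_le_Basis\<close>. The Taylor remainder comes from the mean value inequality on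
  the segment from \<open>z\<close> to \<open>z + y\<close>, where the derivative differs from
  \<open>D z\<close> by at most \<open>C * norm y\<close>.\<close>

lemma C2_bounded_lipschitz_imp_C11:
  fixes f :: "'z::euclidean_space \<Rightarrow> 'y::euclidean_space" and L K C :: real
  assumes f: "C2_bounded_lipschitz L K f" and C: "real DIM('z) * L \<le> C" "real DIM('z) * K \<le> C"
  shows "C11 C f"
proof -
  obtain D :: "'z \<Rightarrow> 'z \<Rightarrow>\<^sub>L 'y" where
    D: "\<And>z. (f has_derivative blinfun_apply (D z)) (at z)"
    and L: "\<And>i z. i \<in> Basis \<Longrightarrow> norm (blinfun_apply (D z) i) \<le> L"
    and K: "\<And>i. i \<in> Basis \<Longrightarrow> K-lipschitz_on UNIV (\<lambda>z. blinfun_apply (D z) i)"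
    using f unfolding C2_bounded_lipschitz_def by blast
  have lin: "linear (blinfun_apply A)" for A :: "'z \<Rightarrow>\<^sub>L 'y"
    by (simp add: blinfun.bounded_linear_right bounded_linear.linear)
  have K0: "0 \<le> K"
    using K[OF SOME_Basis] by (rule lipschitz_on_nonneg)
  then have C0: "0 \<le> C"
    using C(2) by (smt (verit) mult_nonneg_nonneg of_nat_0_le_iff)
  have bound: "norm (blinfun_apply (D z) y) \<le> C * norm y" for z y
  proof -
    have "norm (blinfun_apply (D z) y) \<le> real DIM('z) * L * norm y"
      by (rule norm_linear_le_Basis[OF lin L])
    also have "\<dots> \<le> C * norm y" using C by (intro mult_right_mono) auto
    finally show ?thesis .
  qed
  have lip: "norm (blinfun_apply (D z) y - blinfun_apply (D z') y) \<le> C * norm (z - z') * norm y" for z z' y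
  proof -
    have "norm (blinfun_apply (D z - D z') i) \<le> K * norm (z - z')" if "i \<in> Basis" for i
      using lipschitz_onD[OF K[OF that], of z z'] by (simp add: dist_norm blinfun.diff_left)
    from norm_linear_le_Basis[OF lin this]
    have "norm (blinfun_apply (D z - D z') y) \<le> (real DIM('z) * K) * (norm (z - z') * norm y)"
      by (simp add: mult_ac)
    also have "\<dots> \<le> C * (norm (z - z') * norm y)"
      using C by (intro mult_right_mono) auto
    finally show ?thesis by (simp add: blinfun.diff_left mult_ac)
  qed
  have rem: "norm (f (z + y) - f z - blinfun_apply (D z) y) \<le> C * (norm y)\<^sup>2" for z y
  proof -
    define S where "S = (\<lambda>t. z + t *\<^sub>R y) ` {0..1}"
    have "norm (f (z + y) - f z - blinfun_apply (D z) (z + y - z)) \<le> norm (z + y - z) * (C * norm y)"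
    proof (rule differentiable_bound_linearization[where S = S])
      fix x assume "x \<in> S"
      then obtain t where t: "0 \<le> t" "t \<le> 1" "x = z + t *\<^sub>R y" by (auto simp: S_def)
      show "(f has_derivative blinfun_apply (D x)) (at x within S)"
        using D has_derivative_at_withinI by blast
      show "onorm (blinfun_apply (D x) - blinfun_apply (D z)) \<le> C * norm y"
      proof (rule onorm_le)
        fix w
        have "norm (blinfun_apply (D x) w - blinfun_apply (D z) w) \<le> C * norm (x - z) * norm w" by (rule lip)
        also have "\<dots> \<le> C * norm y * norm w"
          using t C0 by (intro mult_right_mono mult_left_mono) (auto intro: mult_left_le_one_le)
        finally show "norm ((blinfun_apply (D x) - blinfun_apply (D z)) w) \<le> C * norm y * norm w"
          by simp
      qed
    qed (auto simp: S_def image_iff intro: bexI[of _ 0])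
    then show ?thesis by (simp add: power2_eq_square mult_ac)
  qed
  show ?thesis
    unfolding C11_def using D bound rem C0 by (auto intro!: exI[of _ "\<lambda>z. blinfun_apply (D z)"])
qed

section \<open>Lipschitz bounds, partial derivatives, adjoints and gradients\<close>

lemma C11_lipschitz:
  assumes "C11 C f"
  shows "norm (f x - f y) \<le> C * norm (x - y)"
proof -
  obtain D where D: "\<And>z. (f has_derivative D z) (at z)" "\<And>z y. norm (D z y) \<le> C * norm y"
    and "0 \<le> C"
    using assms unfolding C11_def by blast
  have "onorm (D z) \<le> C" for z
    using D \<open>0 \<le> C\<close> by (auto intro: onorm_bound)
  with D show ?thesis
    by (intro differentiable_bound[where S = UNIV and f' = D]) auto
qed

lemma C11_continuous: "C11 C f \<Longrightarrow> continuous_on S f"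
  unfolding C11_def
  by (meson continuous_at_imp_continuous_on has_derivative_continuous)

text \<open>The assumptions concern the joint derivative \<open>D\<close> in \<open>(x, c)\<close>,
  while costate and gradient are built from partial ones. Restricting \<open>D\<close> to the two
  axes yields both, and \<open>norm (y, v) \<le> norm y + norm v\<close> brings the joint remainder
  into this form.\<close>

lemma C11_partialE:
  fixes f :: "'x::real_normed_vector \<Rightarrow> 'c::real_normed_vector \<Rightarrow> 'y::real_normed_vector"
  assumes "C11 C (\<lambda>(x, c). f x c)"
  obtains fx fc where "((\<lambda>x. f x c) has_derivative fx) (at x)" "((\<lambda>c. f x c) has_derivative fc) (at c)"
    "\<And>y. norm (fx y) \<le> C * norm y" "\<And>v. norm (fc v) \<le> C * norm v"
    "\<And>y v. norm (f (x + y) (c + v) - f x c - fx y - fc v) \<le> C * (norm y + norm v)\<^sup>2"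
proof -
  obtain D where D: "\<And>z. ((\<lambda>(x, c). f x c) has_derivative D z) (at z)"
    and B: "\<And>z y. norm (D z y) \<le> C * norm y"
    and R: "\<And>z y. norm ((\<lambda>(x, c). f x c) (z + y) - (\<lambda>(x, c). f x c) z - D z y) \<le> C * (norm y)\<^sup>2"
    and C: "0 \<le> C"
    using assms unfolding C11_def by blast
  have lin: "linear (D (x, c))"
    using D has_derivative_linear by blast
  let ?fx = "\<lambda>y. D (x, c) (y, 0)" and ?fc = "\<lambda>v. D (x, c) (0, v)"
  have pair: "((\<lambda>x. (x, c)) has_derivative (\<lambda>y. (y, 0))) (at x)"
    "((\<lambda>c. (x, c)) has_derivative (\<lambda>v. (0, v))) (at c)"
    by (auto intro!: derivative_eq_intros)
  have "((\<lambda>x. f x c) has_derivative ?fx) (at x)"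
    using has_derivative_compose[OF pair(1) D] by simp
  moreover have "((\<lambda>c. f x c) has_derivative ?fc) (at c)"
    using has_derivative_compose[OF pair(2) D] by simp
  moreover have "norm (?fx y) \<le> C * norm y" "norm (?fc v) \<le> C * norm v" for y v
    using B[of "(x, c)" "(y, 0)"] B[of "(x, c)" "(0, v)"] by (simp_all add: norm_Pair)
  moreover have "norm (f (x + y) (c + v) - f x c - ?fx y - ?fc v) \<le> C * (norm y + norm v)\<^sup>2" for y v
  proof -
    have "D (x, c) (y, v) = ?fx y + ?fc v"
      using linear_add[OF lin, of "(y, 0)" "(0, v)"] by simp
    then have "norm (f (x + y) (c + v) - f x c - ?fx y - ?fc v) \<le> C * (norm (y, v))\<^sup>2"
      using R[of "(x, c)" "(y, v)"] by (simp add: algebra_simps)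
    also have "\<dots> \<le> C * (norm y + norm v)\<^sup>2"
      using C norm_Pair_le[of y v] by (intro mult_left_mono power_mono) auto
    finally show ?thesis .
  qed
  ultimately show ?thesis by (rule that)
qed

lemma C11_partial_lipschitz:
  assumes "C11 C (\<lambda>(x, c). f x c)"
  shows "norm (f (x + y) (c + v) - f x c) \<le> C * (norm y + norm v)"
proof -
  have C: "0 \<le> C" using assms by (simp add: C11_def)
  have "norm (f (x + y) (c + v) - f x c) \<le> C * norm (y, v)"
    using C11_lipschitz[OF assms, of "(x + y, c + v)" "(x, c)"] by simp
  also have "\<dots> \<le> C * (norm y + norm v)"
    using C norm_Pair_le[of y v] by (intro mult_left_mono) auto
  finally show ?thesis .
qed

text \<open>The squared norm of \<open>adjoint f p\<close> is
  \<open>f (adjoint f p) \<bullet> p\<close>; after Cauchy-Schwarz and the bound on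
  \<open>f\<close>, a factor \<open>norm (adjoint f p)\<close> cancels.\<close>

lemma norm_adjoint_le:
  fixes f :: "'x::euclidean_space \<Rightarrow> 'y::euclidean_space"
  assumes "linear f" and f: "\<And>y. norm (f y) \<le> C * norm y" and "0 \<le> C"
  shows "norm (adjoint f p) \<le> C * norm p"
proof -
  have "norm (adjoint f p) * norm (adjoint f p) = f (adjoint f p) \<bullet> p"
    using adjoint_works[OF \<open>linear f\<close>, of "adjoint f p" p]
    by (simp add: dot_square_norm power2_eq_square)
  also have "\<dots> \<le> norm (f (adjoint f p)) * norm p"
    by (rule norm_cauchy_schwarz)
  also have "\<dots> \<le> norm (adjoint f p) * (C * norm p)"
    using mult_right_mono[OF f norm_ge_zero] by (simp add: mult_ac)
  finally have *: "norm (adjoint f p) * norm (adjoint f p) \<le> norm (adjoint f p) * (C * norm p)" .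
  show ?thesis
  proof (cases "adjoint f p = 0")
    case True
    then show ?thesis using \<open>0 \<le> C\<close> by simp
  next
    case False
    then show ?thesis using * by simp
  qed
qed

text \<open>\<open>gradient\<close> is a definite description, so existence and uniqueness have to
  be supplied: \<open>adjoint D 1\<close> represents \<open>D\<close>, and uniqueness of the
  derivative excludes any other vector.\<close>

lemma gradient_works:
  fixes f :: "'z::euclidean_space \<Rightarrow> real"
  assumes D: "(f has_derivative D) (at z)"
  shows "gradient f z \<bullet> y = D y"
proof -
  have lin: "linear D" using D by (rule has_derivative_linear)
  have eq: "D y = y \<bullet> adjoint D 1" for y
    using adjoint_works[OF lin, of y 1] by simp
  have "GDERIV f z :> adjoint D 1"
    unfolding gderiv_def by (rule has_derivative_eq_rhs[OF D]) (rule ext, rule eq)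
  moreover have "g = adjoint D 1" if "GDERIV f z :> g" for g
  proof -
    have *: "(\<lambda>y. y \<bullet> g) = D"
      using that D unfolding gderiv_def by (rule has_derivative_unique)
    have "y \<bullet> g = y \<bullet> adjoint D 1" for y
      using fun_cong[OF *, of y] eq[of y] by simp
    then show ?thesis using vector_eq_ldot by blast
  qed
  ultimately have "gradient f z = adjoint D 1"
    unfolding gradient_def by (rule the_equality)
  then show ?thesis using eq[of y] by (simp only: inner_commute)
qed

text \<open>Testing the derivative on the gradient itself bounds the squared norm by
  \<open>C\<close> times the norm.\<close>

lemma norm_gradient_le:
  fixes f :: "'z::euclidean_space \<Rightarrow> real"
  assumes "(f has_derivative D) (at z)" and D: "\<And>y. norm (D y) \<le> C * norm y" and "0 \<le> C"
  shows "norm (gradient f z) \<le> C"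
proof -
  have "norm (gradient f z) * norm (gradient f z) \<le> C * norm (gradient f z)"
    using gradient_works[OF assms(1), of "gradient f z"] D[of "gradient f z"]
    by (simp add: dot_square_norm power2_eq_square)
  then show ?thesis using \<open>0 \<le> C\<close> by (cases "gradient f z = 0") auto
qed


section \<open>Pathwise expansion of the cost\<close>

text \<open>Deterministic setting: noise \<open>z\<close> and control \<open>w\<close> are arbitrary
  sequences, so the estimates hold for each realisation, with explicit dependence on
  \<open>z\<close>.\<close>

locale controlled_recursion =
  fixes N :: nat and h C :: real
    and b \<sigma> :: "nat \<Rightarrow> 'x::euclidean_space \<Rightarrow> 'c::euclidean_space \<Rightarrow> 'x"
    and \<Phi> :: "'x \<Rightarrow> real" and l :: "nat \<Rightarrow> 'x \<Rightarrow> 'c \<Rightarrow> real" and x0 :: 'x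
  assumes h_pos: "0 < h" and C11_\<Phi>: "C11 C \<Phi>"
    and C11_b: "n < N \<Longrightarrow> C11 C (\<lambda>(x, c). b n x c)"
    and C11_\<sigma>: "n < N \<Longrightarrow> C11 C (\<lambda>(x, c). \<sigma> n x c)"
    and C11_l: "n < N \<Longrightarrow> C11 C (\<lambda>(x, c). l n x c)"
begin

lemma C_nonneg: "0 \<le> C"
  using C11_\<Phi> unfolding C11_def by blast

abbreviation "st \<equiv> state h b \<sigma> x0"
abbreviation "pc \<equiv> path_cost N h b \<sigma> \<Phi> l x0"
abbreviation "cs z w \<equiv> costate N h b \<sigma> \<Phi> l (st z w) z w"
abbreviation "pg z w \<equiv> path_gradient N h b \<sigma> \<Phi> l (st z w) z w"

text \<open>Bounds the amplification in one step, forward for the state as well as backward for the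
  costate. Summing over all \<open>\<bar>z k\<bar>\<close> makes it the same at every step, so that
  the bounds accumulate as powers; the inner \<open>1\<close> covers the drift when the noise
  vanishes.\<close>

definition growth :: "(nat \<Rightarrow> real) \<Rightarrow> real" where
  "growth z = 1 + (h + sqrt h) * C * (1 + (\<Sum>k<N. \<bar>z k\<bar>))"

lemma growth_ge:
  shows "1 \<le> growth z" and "h * C \<le> growth z - 1"
    and "n < N \<Longrightarrow> (h + sqrt h * \<bar>z n\<bar>) * C \<le> growth z - 1"
proof -
  define S where "S = 1 + (\<Sum>k<N. \<bar>z k\<bar>)"
  have S: "1 \<le> S" by (simp add: S_def sum_nonneg)
  have "h * 1 * C \<le> (h + sqrt h) * S * C"
    using h_pos S C_nonneg by (intro mult_right_mono mult_mono) auto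
  then show "h * C \<le> growth z - 1" by (simp add: growth_def S_def mult_ac)
  then show "1 \<le> growth z" using h_pos C_nonneg
    by (smt (verit) mult_nonneg_nonneg)
  assume "n < N"
  then have "\<bar>z n\<bar> \<le> S"
    using member_le_sum[of n "{..<N}" "\<lambda>k. \<bar>z k\<bar>"] by (simp add: S_def)
  then have "h * 1 + sqrt h * \<bar>z n\<bar> \<le> h * S + sqrt h * S"
    using h_pos S by (intro add_mono mult_left_mono) auto
  then have "(h + sqrt h * \<bar>z n\<bar>) * C \<le> (h * S + sqrt h * S) * C"
    using C_nonneg by (intro mult_right_mono) auto
  then show "(h + sqrt h * \<bar>z n\<bar>) * C \<le> growth z - 1"
    by (simp add: growth_def S_def algebra_simps)
qed

text \<open>Discrete Gronwall argument. Adding the total size of the perturbation to the state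
  difference makes the one-step inequality homogeneous: the sum grows by a factor of at most
  \<open>growth z\<close>.\<close>

lemma norm_state_diff_le:
  assumes "n \<le> N"
  shows "norm (st z (\<lambda>k. w k + v k) n - st z w n) + (\<Sum>k<N. norm (v k))
    \<le> growth z ^ n * (\<Sum>k<N. norm (v k))"
  using assms
proof (induction n)
  case 0
  then show ?case by simp
next
  case (Suc n)
  define V where "V = (\<Sum>k<N. norm (v k))"
  define x where "x = st z w n"
  define y where "y = st z (\<lambda>k. w k + v k) n - x"
  have n: "n < N" using Suc by simp
  have V: "norm (v n) \<le> V"
    using member_le_sum[of n "{..<N}" "\<lambda>k. norm (v k)"] n by (simp add: V_def)
  let ?db = "b n (x + y) (w n + v n) - b n x (w n)"
  let ?ds = "\<sigma> n (x + y) (w n + v n) - \<sigma> n x (w n)"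
  have "C * (norm y + norm (v n)) \<le> C * (norm y + V)"
    using V C_nonneg by (intro mult_left_mono) auto
  then have d: "norm ?db \<le> C * (norm y + V)" "norm ?ds \<le> C * (norm y + V)"
    using C11_partial_lipschitz[OF C11_b[OF n]] C11_partial_lipschitz[OF C11_\<sigma>[OF n]] order_trans
    by blast+
  have "st z (\<lambda>k. w k + v k) (Suc n) - st z w (Suc n) = y + h *\<^sub>R ?db + (sqrt h * z n) *\<^sub>R ?ds"
    by (simp add: x_def y_def algebra_simps)
  also have "norm \<dots> \<le> norm y + h * norm ?db + sqrt h * \<bar>z n\<bar> * norm ?ds"
    using h_pos by (intro norm_triangle_le add_mono) (auto simp: abs_mult)
  also have "\<dots> \<le> norm y + h * (C * (norm y + V)) + sqrt h * \<bar>z n\<bar> * (C * (norm y + V))"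
    using h_pos d by (intro add_mono mult_left_mono) auto
  also have "\<dots> = norm y + (h + sqrt h * \<bar>z n\<bar>) * C * (norm y + V)"
    by (simp add: algebra_simps)
  also have "\<dots> \<le> norm y + (growth z - 1) * (norm y + V)"
    using growth_ge(3)[OF n] order_trans[OF norm_ge_zero V]
    by (intro add_left_mono mult_right_mono) auto
  finally have "norm (st z (\<lambda>k. w k + v k) (Suc n) - st z w (Suc n)) + V \<le> growth z * (norm y + V)"
    by (simp add: algebra_simps)
  also have "\<dots> \<le> growth z * (growth z ^ n * V)"
    using Suc growth_ge(1)[of z] by (intro mult_left_mono) (auto simp: V_def x_def y_def)
  finally show ?case by (simp add: V_def mult_ac)
qed

section \<open>The costate, its growth and its pairing with state increments\<close>

lemma costate_last: "cs z w N = gradient \<Phi> (st z w N)"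
  by (simp add: costate.simps)

text \<open>Given derivatives replace the terms \<open>frechet_derivative\<close> of the definition.
  The first form keeps the adjoints, for norm estimates; the second moves them onto the test vector
  \<open>y\<close>, where drift and noise recombine into one step of the linearised state
  equation.\<close>

lemma costate_step:
  assumes n: "n < N"
    and bx: "((\<lambda>x. b n x (w n)) has_derivative bx) (at (st z w n))"
    and \<sigma>x: "((\<lambda>x. \<sigma> n x (w n)) has_derivative \<sigma>x) (at (st z w n))"
    and lx: "((\<lambda>x. l n x (w n)) has_derivative lx) (at (st z w n))"
  shows "cs z w n = adjoint (\<lambda>y. y + h *\<^sub>R bx y) (cs z w (Suc n))
      + z n *\<^sub>R adjoint (\<lambda>y. sqrt h *\<^sub>R \<sigma>x y) (cs z w (Suc n))
      + h *\<^sub>R gradient (\<lambda>x. l n x (w n)) (st z w n)"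
    and "cs z w n \<bullet> y = cs z w (Suc n) \<bullet> (y + h *\<^sub>R bx y + (sqrt h * z n) *\<^sub>R \<sigma>x y) + h * lx y"
proof -
  show *: "cs z w n = adjoint (\<lambda>y. y + h *\<^sub>R bx y) (cs z w (Suc n))
      + z n *\<^sub>R adjoint (\<lambda>y. sqrt h *\<^sub>R \<sigma>x y) (cs z w (Suc n))
      + h *\<^sub>R gradient (\<lambda>x. l n x (w n)) (st z w n)"
    using n frechet_derivative_at[OF bx] frechet_derivative_at[OF \<sigma>x]
    by (subst costate.simps) (simp add: lin_A_def lin_B_def lin_Lambda_def)
  have "linear (\<lambda>y. y + h *\<^sub>R bx y)" "linear (\<lambda>y. sqrt h *\<^sub>R \<sigma>x y)"
    using has_derivative_linear[OF bx] has_derivative_linear[OF \<sigma>x]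
    by (auto intro!: linear_compose_add linear_compose_scale_right linear_id[unfolded id_def])
  note adj = adjoint_works[OF this(1)] adjoint_works[OF this(2)]
  have "cs z w n \<bullet> y = y \<bullet> cs z w n" by (rule inner_commute)
  also have "\<dots> = (y + h *\<^sub>R bx y) \<bullet> cs z w (Suc n) + z n * ((sqrt h *\<^sub>R \<sigma>x y) \<bullet> cs z w (Suc n)) + h * lx y"
    unfolding * using gradient_works[OF lx, of y] by (simp add: inner_add_right adj inner_commute)
  also have "\<dots> = cs z w (Suc n) \<bullet> (y + h *\<^sub>R bx y + (sqrt h * z n) *\<^sub>R \<sigma>x y) + h * lx y"
    by (simp add: inner_simps inner_commute)
  finally show "cs z w n \<bullet> y = cs z w (Suc n) \<bullet> (y + h *\<^sub>R bx y + (sqrt h * z n) *\<^sub>R \<sigma>x y) + h * lx y" .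
qed

text \<open>The weight \<open>h\<close> turns the coefficient \<open>h powr (- 1 / 2)\<close> of the
  noise term into the \<open>sqrt h\<close> of the state equation, so the gradient pairs with
  \<open>v\<close> as the control part of the linearised step does with the costate.\<close>

lemma path_gradient_inner:
  assumes bc: "((\<lambda>c. b n (st z w n) c) has_derivative bc) (at (w n))"
    and \<sigma>c: "((\<lambda>c. \<sigma> n (st z w n) c) has_derivative \<sigma>c) (at (w n))"
    and lc: "((\<lambda>c. l n (st z w n) c) has_derivative lc) (at (w n))"
  shows "h * (pg z w n \<bullet> v) = cs z w (Suc n) \<bullet> (h *\<^sub>R bc v + (sqrt h * z n) *\<^sub>R \<sigma>c v) + h * lc v"
proof -
  note adj = adjoint_works[OF has_derivative_linear[OF bc]] adjoint_works[OF has_derivative_linear[OF \<sigma>c]]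
  have "h powr (-1/2) = inverse (sqrt h)"
    using h_pos by (simp add: powr_minus powr_half_sqrt)
  then have hh: "h * h powr (-1/2) = sqrt h"
    using h_pos by (metis divide_inverse less_imp_le real_div_sqrt)
  have "h * (pg z w n \<bullet> v) = h * (v \<bullet> pg z w n)" by (simp add: inner_commute)
  also have "\<dots> = h * (bc v \<bullet> cs z w (Suc n)) + h * lc v
      + h * h powr (-1/2) * z n * (\<sigma>c v \<bullet> cs z w (Suc n))"
    unfolding path_gradient_def frechet_derivative_at[OF bc, symmetric]
      frechet_derivative_at[OF \<sigma>c, symmetric]
    using gradient_works[OF lc, of v] by (simp add: inner_add_right adj inner_commute algebra_simps)
  finally show ?thesis unfolding hh by (simp add: inner_simps inner_commute)
qed

text \<open>Gronwall argument run backward from \<open>N\<close>, where the gradient of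
  \<open>\<Phi>\<close> has norm at most \<open>C\<close>. The summand \<open>1\<close> absorbs the
  source term \<open>h * C\<close>. The bound is uniform in the control because the derivatives are
  bounded globally.\<close>

lemma norm_costate_le:
  assumes "n \<le> N"
  shows "norm (cs z w n) + 1 \<le> (C + 1) * growth z ^ (N - n)"
  using assms
proof (induction n rule: inc_induct)
  case base
  obtain D where "(\<Phi> has_derivative D) (at (st z w N))" "\<And>y. norm (D y) \<le> C * norm y"
    using C11_\<Phi> unfolding C11_def by blast
  from norm_gradient_le[OF this C_nonneg] show ?case by (simp add: costate_last)
next
  case (step n)
  define p where "p = cs z w (Suc n)"
  have n: "n < N" using step by simp
  obtain bx where bx: "((\<lambda>x. b n x (w n)) has_derivative bx) (at (st z w n))" "\<And>y. norm (bx y) \<le> C * norm y"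
    using C11_partialE[OF C11_b[OF n]] by metis
  obtain \<sigma>x where \<sigma>x: "((\<lambda>x. \<sigma> n x (w n)) has_derivative \<sigma>x) (at (st z w n))" "\<And>y. norm (\<sigma>x y) \<le> C * norm y"
    using C11_partialE[OF C11_\<sigma>[OF n]] by metis
  obtain lx where lx: "((\<lambda>x. l n x (w n)) has_derivative lx) (at (st z w n))" "\<And>y. norm (lx y) \<le> C * norm y"
    using C11_partialE[OF C11_l[OF n]] by metis
  have lin: "linear (\<lambda>y. y + h *\<^sub>R bx y)" "linear (\<lambda>y. sqrt h *\<^sub>R \<sigma>x y)"
    using has_derivative_linear[OF bx(1)] has_derivative_linear[OF \<sigma>x(1)]
    by (auto intro!: linear_compose_add linear_compose_scale_right linear_id[unfolded id_def])
  have "norm (y + h *\<^sub>R bx y) \<le> (1 + h * C) * norm y" for y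
    using h_pos mult_left_mono[OF bx(2)[of y], of h]
    by (intro norm_triangle_le) (simp add: algebra_simps)
  then have a: "norm (adjoint (\<lambda>y. y + h *\<^sub>R bx y) p) \<le> (1 + h * C) * norm p"
    using h_pos C_nonneg by (intro norm_adjoint_le[OF lin(1)]) auto
  have "norm (sqrt h *\<^sub>R \<sigma>x y) \<le> (sqrt h * C) * norm y" for y
    using h_pos mult_left_mono[OF \<sigma>x(2)[of y], of "sqrt h"] by (simp add: mult_ac)
  then have s: "norm (adjoint (\<lambda>y. sqrt h *\<^sub>R \<sigma>x y) p) \<le> (sqrt h * C) * norm p"
    using h_pos C_nonneg by (intro norm_adjoint_le[OF lin(2)]) auto
  have g: "norm (gradient (\<lambda>x. l n x (w n)) (st z w n)) \<le> C"
    by (rule norm_gradient_le[OF lx C_nonneg])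
  have "norm (cs z w n) \<le> (1 + h * C) * norm p + \<bar>z n\<bar> * ((sqrt h * C) * norm p) + h * C"
    unfolding costate_step(1)[OF n bx(1) \<sigma>x(1) lx(1)] p_def[symmetric]
    using h_pos g a s by (intro norm_triangle_le add_mono) (auto intro: mult_left_mono)
  also have "\<dots> = norm p + (h + sqrt h * \<bar>z n\<bar>) * C * norm p + h * C"
    by (simp add: algebra_simps)
  also have "\<dots> \<le> norm p + (growth z - 1) * norm p + (growth z - 1)"
    using growth_ge(2,3)[where z = z] n by (intro add_mono mult_right_mono) auto
  finally have "norm (cs z w n) + 1 \<le> growth z * (norm p + 1)"
    by (simp add: algebra_simps)
  also have "\<dots> \<le> growth z * ((C + 1) * growth z ^ (N - Suc n))"
    using step growth_ge(1)[of z] by (intro mult_left_mono) (auto simp: p_def)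
  also have "\<dots> = (C + 1) * growth z ^ (Suc (N - Suc n))" by simp
  also have "Suc (N - Suc n) = N - n" using n by simp
  finally show ?case .
qed

text \<open>The adjoint recursion is exactly what makes the first-order terms cancel here, so that the
  linearised state never appears.\<close>

lemma hamiltonian_step:
  fixes z :: "nat \<Rightarrow> real" and w v :: "nat \<Rightarrow> 'c"
  assumes n: "n < N"
  defines "x \<equiv> st z w n" and "x' \<equiv> st z (\<lambda>k. w k + v k) n"
  shows "\<bar>cs z w (Suc n) \<bullet> (st z (\<lambda>k. w k + v k) (Suc n) - st z w (Suc n)) - cs z w n \<bullet> (x' - x)
      + h * (l n x' (w n + v n) - l n x (w n)) - h * (pg z w n \<bullet> v n)\<bar>
    \<le> (norm (cs z w (Suc n)) + 1) * growth z * (norm (x' - x) + norm (v n))\<^sup>2"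
proof -
  define p where "p = cs z w (Suc n)"
  define y where "y = x' - x"
  have x': "x' = x + y" by (simp add: y_def)
  define e where "e = (norm y + norm (v n))\<^sup>2"
  obtain bx bc where b: "((\<lambda>x. b n x (w n)) has_derivative bx) (at x)" "((\<lambda>c. b n x c) has_derivative bc) (at (w n))"
    "norm (b n x' (w n + v n) - b n x (w n) - bx y - bc (v n)) \<le> C * e"
    using C11_partialE[OF C11_b[OF n]] unfolding e_def x' by metis
  obtain \<sigma>x \<sigma>c where \<sigma>: "((\<lambda>x. \<sigma> n x (w n)) has_derivative \<sigma>x) (at x)" "((\<lambda>c. \<sigma> n x c) has_derivative \<sigma>c) (at (w n))"
    "norm (\<sigma> n x' (w n + v n) - \<sigma> n x (w n) - \<sigma>x y - \<sigma>c (v n)) \<le> C * e"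
    using C11_partialE[OF C11_\<sigma>[OF n]] unfolding e_def x' by metis
  obtain lx lc where l: "((\<lambda>x. l n x (w n)) has_derivative lx) (at x)" "((\<lambda>c. l n x c) has_derivative lc) (at (w n))"
    "norm (l n x' (w n + v n) - l n x (w n) - lx y - lc (v n)) \<le> C * e"
    using C11_partialE[OF C11_l[OF n]] unfolding e_def x' by metis
  define rb where "rb = b n x' (w n + v n) - b n x (w n) - bx y - bc (v n)"
  define rs where "rs = \<sigma> n x' (w n + v n) - \<sigma> n x (w n) - \<sigma>x y - \<sigma>c (v n)"
  define rl where "rl = l n x' (w n + v n) - l n x (w n) - lx y - lc (v n)"
  have e: "0 \<le> e" by (simp add: e_def)
  \<comment> \<open>Splits the state increment into a part linear in \<open>y\<close>, a part linear
    in \<open>v n\<close> and the Taylor remainders. The facts \<open>c\<close> and \<open>g\<close>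
    match the two linear parts with the costate and with the path gradient.\<close>
  have st: "st z (\<lambda>k. w k + v k) (Suc n) - st z w (Suc n)
      = (y + h *\<^sub>R bx y + (sqrt h * z n) *\<^sub>R \<sigma>x y) + (h *\<^sub>R bc (v n) + (sqrt h * z n) *\<^sub>R \<sigma>c (v n))
        + (h *\<^sub>R rb + (sqrt h * z n) *\<^sub>R rs)"
    by (simp add: rb_def rs_def y_def x_def x'_def algebra_simps)
  have c: "cs z w n \<bullet> y = p \<bullet> (y + h *\<^sub>R bx y + (sqrt h * z n) *\<^sub>R \<sigma>x y) + h * lx y"
    unfolding p_def by (rule costate_step(2)[OF n]) (use b \<sigma> l in \<open>auto simp: x_def\<close>)
  have g: "h * (pg z w n \<bullet> v n) = p \<bullet> (h *\<^sub>R bc (v n) + (sqrt h * z n) *\<^sub>R \<sigma>c (v n)) + h * lc (v n)"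
    unfolding p_def by (rule path_gradient_inner) (use b \<sigma> l in \<open>auto simp: x_def\<close>)
  have "p \<bullet> (st z (\<lambda>k. w k + v k) (Suc n) - st z w (Suc n)) - cs z w n \<bullet> y
      + h * (l n x' (w n + v n) - l n x (w n)) - h * (pg z w n \<bullet> v n)
      = p \<bullet> (h *\<^sub>R rb + (sqrt h * z n) *\<^sub>R rs) + h * rl"
    unfolding st c g by (simp add: rl_def inner_add_right algebra_simps)
  also have "\<bar>\<dots>\<bar> \<le> norm p * (h * norm rb + sqrt h * \<bar>z n\<bar> * norm rs) + h * \<bar>rl\<bar>"
  proof -
    have "\<bar>p \<bullet> (h *\<^sub>R rb + (sqrt h * z n) *\<^sub>R rs)\<bar> \<le> norm p * norm (h *\<^sub>R rb + (sqrt h * z n) *\<^sub>R rs)"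
      by (rule Cauchy_Schwarz_ineq2)
    also have "\<dots> \<le> norm p * (h * norm rb + sqrt h * \<bar>z n\<bar> * norm rs)"
      using h_pos by (intro mult_left_mono norm_triangle_le) (auto simp: abs_mult)
    finally show ?thesis
      using h_pos by (intro order_trans[OF abs_triangle_ineq] add_mono) (auto simp: abs_mult)
  qed
  also have "\<dots> \<le> norm p * (h * (C * e) + sqrt h * \<bar>z n\<bar> * (C * e)) + h * (C * e)"
    using h_pos b(3) \<sigma>(3) l(3) unfolding rb_def rs_def rl_def real_norm_def
    by (intro add_mono mult_left_mono) auto
  also have "\<dots> = norm p * ((h + sqrt h * \<bar>z n\<bar>) * C * e) + h * C * e"
    by (simp add: algebra_simps)
  also have "\<dots> \<le> norm p * (growth z * e) + growth z * e"
    using growth_ge(2)[of z] growth_ge(3)[OF n, of z] e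
    by (intro add_mono mult_left_mono mult_right_mono) auto
  finally show ?thesis by (simp add: p_def e_def y_def algebra_simps)
qed

text \<open>Summing \<open>hamiltonian_step\<close> leaves the pairing at time \<open>N\<close>,
  which is the first-order term of \<open>\<Phi>\<close>. The \<open>N\<close> step remainders and
  the terminal one obey the same bound \<open>G\<close>, hence the factor
  \<open>N + 1\<close>.\<close>

lemma path_cost_expansion:
  "\<bar>pc z (\<lambda>k. w k + v k) - pc z w - h * (\<Sum>n<N. pg z w n \<bullet> v n)\<bar>
    \<le> (N + 1) * (C + 1) * growth z ^ (2 * N) * (\<Sum>k<N. norm (v k))\<^sup>2"
proof -
  define V where "V = (\<Sum>k<N. norm (v k))"
  define G where "G = (C + 1) * growth z ^ (2 * N) * V\<^sup>2"
  define x where "x = st z w"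
  define x' where "x' = st z (\<lambda>k. w k + v k)"
  define r where "r n = cs z w (Suc n) \<bullet> (x' (Suc n) - x (Suc n)) - cs z w n \<bullet> (x' n - x n)
      + h * (l n (x' n) (w n + v n) - l n (x n) (w n)) - h * (pg z w n \<bullet> v n)" for n
  note g1 = growth_ge(1)[of z]
  have V0: "0 \<le> V" by (simp add: V_def sum_nonneg)
  have dx: "norm (x' n - x n) + V \<le> growth z ^ n * V" if "n \<le> N" for n
    using norm_state_diff_le[OF that] by (simp add: x_def x'_def V_def)
  have r: "\<bar>r n\<bar> \<le> G" if n: "n < N" for n
  proof -
    have "norm (v n) \<le> V"
      using member_le_sum[of n "{..<N}" "\<lambda>k. norm (v k)"] n by (simp add: V_def)
    then have y: "norm (x' n - x n) + norm (v n) \<le> growth z ^ n * V"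
      using dx[of n] n by simp
    have "\<bar>r n\<bar> \<le> (norm (cs z w (Suc n)) + 1) * growth z * (norm (x' n - x n) + norm (v n))\<^sup>2"
      unfolding r_def x_def x'_def by (rule hamiltonian_step[OF n])
    also have "\<dots> \<le> ((C + 1) * growth z ^ (N - Suc n)) * growth z * (growth z ^ n * V)\<^sup>2"
      using norm_costate_le[of "Suc n" z w] n g1 y C_nonneg
      by (intro mult_mono mult_right_mono power_mono) auto
    \<comment> \<open>Exponents of \<open>growth z\<close>: \<open>N - Suc n\<close> from the
      costate, one from the step, \<open>2 * n\<close> from the squared state difference. The total
      \<open>N + n\<close> is below \<open>2 * N\<close>.\<close>
    also have "\<dots> = (C + 1) * growth z ^ (N + n) * V\<^sup>2"
    proof -
      have "growth z ^ (N + n) = growth z ^ ((N - Suc n) + 1 + 2 * n)"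
        using n by (intro arg_cong[where f = "(^) (growth z)"]) simp
      also have "\<dots> = growth z ^ (N - Suc n) * growth z * (growth z ^ n)\<^sup>2"
        by (simp only: power_add power_one_right power_mult[symmetric] mult.commute[of n])
      finally show ?thesis by (simp add: power_mult_distrib)
    qed
    also have "\<dots> \<le> G"
      unfolding G_def using n g1 C_nonneg by (intro mult_right_mono mult_left_mono power_increasing) auto
    finally show ?thesis .
  qed
  obtain D where D: "(\<Phi> has_derivative D) (at (x N))"
    and rem: "\<And>y. norm (\<Phi> (x N + y) - \<Phi> (x N) - D y) \<le> C * (norm y)\<^sup>2"
    using C11_\<Phi> unfolding C11_def by blast
  define rN where "rN = \<Phi> (x' N) - \<Phi> (x N) - cs z w N \<bullet> (x' N - x N)"
  have "cs z w N \<bullet> (x' N - x N) = D (x' N - x N)"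
    using gradient_works[OF D] by (simp add: costate_last x_def)
  then have "\<bar>rN\<bar> \<le> C * (norm (x' N - x N))\<^sup>2"
    using rem[of "x' N - x N"] by (simp add: rN_def)
  also have "\<dots> \<le> (C + 1) * (growth z ^ N * V)\<^sup>2"
    using dx[of N] V0 C_nonneg by (intro mult_mono power_mono) auto
  also have "\<dots> = G" by (simp add: G_def power_mult_distrib power_mult[symmetric] mult.commute)
  finally have rN: "\<bar>rN\<bar> \<le> G" .
  \<comment> \<open>The boundary term at index 0 vanishes because both trajectories start at
    \<open>x0\<close>.\<close>
  have "(\<Sum>n<N. cs z w (Suc n) \<bullet> (x' (Suc n) - x (Suc n)) - cs z w n \<bullet> (x' n - x n))
      = cs z w N \<bullet> (x' N - x N)"
    by (subst sum_lessThan_telescope) (simp add: x_def x'_def)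
  then have "pc z (\<lambda>k. w k + v k) - pc z w - h * (\<Sum>n<N. pg z w n \<bullet> v n) = rN + (\<Sum>n<N. r n)"
    by (simp add: path_cost_def rN_def r_def x_def x'_def sum.distrib sum_subtractf
        sum_distrib_left right_diff_distrib)
  also have "\<bar>\<dots>\<bar> \<le> G + (\<Sum>n<N. G)"
    using rN r by (intro order_trans[OF abs_triangle_ineq] add_mono order_trans[OF sum_abs] sum_mono) auto
  also have "\<dots> = (N + 1) * (C + 1) * growth z ^ (2 * N) * V\<^sup>2"
    by (simp add: G_def algebra_simps)
  finally show ?thesis by (simp add: V_def)
qed

end


section \<open>Random variables with finite moments\<close>

text \<open>Every order is required because the remainder contains \<open>growth\<close> to the
  power \<open>2 * N\<close>, with \<open>N\<close> arbitrary.\<close>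

definition finite_moments :: "'w measure \<Rightarrow> ('w \<Rightarrow> real) \<Rightarrow> bool" where
  "finite_moments M Y \<longleftrightarrow>
     Y \<in> borel_measurable M \<and> (\<forall>k::nat. integrable M (\<lambda>\<omega>. \<bar>Y \<omega>\<bar> ^ k))"

lemma finite_moments_integrable: "finite_moments M Y \<Longrightarrow> integrable M Y"
  unfolding finite_moments_def
  by (metis (no_types, lifting) Bochner_Integration.integrable_cong integrable_abs_iff power_one_right)

context prob_space
begin

lemma finite_moments_const: "finite_moments M (\<lambda>\<omega>. c)"
  by (simp add: finite_moments_def)

lemma finite_moments_abs: "finite_moments M Y \<Longrightarrow> finite_moments M (\<lambda>\<omega>. \<bar>Y \<omega>\<bar>)"
  by (auto simp: finite_moments_def)

lemma finite_moments_cmult: "finite_moments M Y \<Longrightarrow> finite_moments M (\<lambda>\<omega>. c * Y \<omega>)"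
  by (auto simp: finite_moments_def abs_mult power_mult_distrib)

text \<open>Bounding the sum by twice the maximum works pointwise, whatever the joint law; the noise
  increments may be correlated.\<close>

lemma finite_moments_add:
  assumes "finite_moments M Y" "finite_moments M Z"
  shows "finite_moments M (\<lambda>\<omega>. Y \<omega> + Z \<omega>)"
proof -
  have [measurable]: "Y \<in> borel_measurable M" "Z \<in> borel_measurable M"
    using assms by (auto simp: finite_moments_def)
  have "integrable M (\<lambda>\<omega>. \<bar>Y \<omega> + Z \<omega>\<bar> ^ k)" for k
  proof (rule Bochner_Integration.integrable_bound)
    show "integrable M (\<lambda>\<omega>. 2 ^ k * (\<bar>Y \<omega>\<bar> ^ k + \<bar>Z \<omega>\<bar> ^ k))"
      using assms by (auto simp: finite_moments_def)
    have "\<bar>y + z\<bar> ^ k \<le> 2 ^ k * (\<bar>y\<bar> ^ k + \<bar>z\<bar> ^ k)" for y z :: real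
    proof -
      have "\<bar>y + z\<bar> ^ k \<le> (2 * max \<bar>y\<bar> \<bar>z\<bar>) ^ k"
        by (intro power_mono) auto
      also have "\<dots> \<le> 2 ^ k * (\<bar>y\<bar> ^ k + \<bar>z\<bar> ^ k)"
        by (auto simp: power_mult_distrib max_def)
      finally show ?thesis .
    qed
    then show "AE \<omega> in M. norm (\<bar>Y \<omega> + Z \<omega>\<bar> ^ k) \<le> norm (2 ^ k * (\<bar>Y \<omega>\<bar> ^ k + \<bar>Z \<omega>\<bar> ^ k))"
      by (auto simp: abs_mult)
  qed measurable
  then show ?thesis by (simp add: finite_moments_def)
qed

lemma finite_moments_sum:
  assumes "\<And>i. i \<in> I \<Longrightarrow> finite_moments M (Y i)"
  shows "finite_moments M (\<lambda>\<omega>. \<Sum>i\<in>I. Y i \<omega>)"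
  using assms
  by (induction I rule: infinite_finite_induct) (auto intro: finite_moments_add finite_moments_const)

text \<open>A degenerate variable is almost surely constant. Otherwise the absolute central moments
  of the normal density are finite, and the mean is added back by
  \<open>finite_moments_add\<close>.\<close>

lemma gaussian_rv_finite_moments:
  assumes "gaussian_rv M Y"
  shows "finite_moments M Y"
proof -
  have Y[measurable]: "Y \<in> borel_measurable M"
    using assms by (simp add: gaussian_rv_def)
  consider \<mu> where "AE \<omega> in M. Y \<omega> = \<mu>"
    | \<mu> s where "0 < s" "distributed M lborel Y (\<lambda>y. ennreal (normal_density \<mu> s y))"
    using assms unfolding gaussian_rv_def by blast
  then show ?thesis
  proof cases
    case 1
    have "integrable M (\<lambda>\<omega>. \<bar>Y \<omega>\<bar> ^ k)" for k
    proof (subst integrable_cong_AE)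
      show "AE \<omega> in M. \<bar>Y \<omega>\<bar> ^ k = \<bar>\<mu>\<bar> ^ k" using 1 by auto
    qed auto
    then show ?thesis using Y by (simp add: finite_moments_def)
  next
    case (2 \<mu> s)
    have "integrable M (\<lambda>\<omega>. \<bar>Y \<omega> - \<mu>\<bar> ^ k)" for k
      using distributed_integrable[OF 2(2), of "\<lambda>y. \<bar>y - \<mu>\<bar> ^ k"]
        integrable_normal_moment_abs[OF 2(1), of \<mu> k]
      by simp
    then have "finite_moments M (\<lambda>\<omega>. Y \<omega> - \<mu>)"
      by (simp add: finite_moments_def)
    from finite_moments_add[OF this finite_moments_const[of \<mu>]] show ?thesis by simp
  qed
qed

lemma fgn_finite_moments:
  assumes "fractional_brownian_motion M H B" "0 < h"
  shows "finite_moments M (fgn H h B n)"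
proof (rule gaussian_rv_finite_moments)
  \<comment> \<open>Coefficients in \<open>gaussian_process\<close> are indexed by time. The two
    endpoints differ since \<open>h\<close> is positive, so comparing with the left one selects the
    sign.\<close>
  define c where "c t = (if t = real n * h then - (h powr - H) else h powr - H)" for t
  have "gaussian_process M {0..} B"
    using assms(1) by (simp add: fractional_brownian_motion_def)
  then have "gaussian_rv M (\<lambda>\<omega>. \<Sum>t\<in>{real n * h, real (Suc n) * h}. c t * B t \<omega>)"
    unfolding gaussian_process_def
    by (elim allE[of _ "{real n * h, real (Suc n) * h}"] allE[of _ c] mp) (use assms(2) in auto)
  also have "(\<lambda>\<omega>. \<Sum>t\<in>{real n * h, real (Suc n) * h}. c t * B t \<omega>) = fgn H h B n"
    using assms(2) by (intro ext) (simp add: c_def fgn_def algebra_simps)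
  finally show "gaussian_rv M (fgn H h B n)" .
qed

end

section \<open>Integrability of adapted controls and of their images under Lipschitz maps\<close>

lemma H_ad_integrable:
  fixes u :: "nat \<Rightarrow> 'w \<Rightarrow> 'c::euclidean_space"
  assumes "prob_space M" and \<xi>: "\<And>k. \<xi> k \<in> borel_measurable M"
    and u: "u \<in> H_ad M (innovation_filtration M (innovation \<gamma> \<xi>)) N" and n: "n < N"
  shows "integrable M (u n)"
proof (rule Bochner_Integration.integrable_bound)
  interpret prob_space M by fact
  define \<eta> where "\<eta> = innovation \<gamma> \<xi>"
  have \<eta>: "\<eta> k \<in> borel_measurable M" for k
    unfolding \<eta>_def innovation_def using \<xi> by (intro borel_measurable_sum borel_measurable_times) auto
  \<comment> \<open>The generators are preimages under the innovations, which are measurable as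
    finite linear combinations of the noise; hence adapted controls are measurable with respect to
    \<open>M\<close>.\<close>
  have "subalgebra M (innovation_filtration M \<eta> n)"
    unfolding subalgebra_def innovation_filtration_def
    by (subst sets_measure_of) (auto intro!: sets.sigma_sets_subset simp: space_measure_of_conv measurable_sets[OF \<eta>])
  then show "u n \<in> borel_measurable M"
    using u n unfolding H_ad_def \<eta>_def by (auto intro: measurable_from_subalg)
  show "integrable M (\<lambda>\<omega>. 1 + (norm (u n \<omega>))\<^sup>2)"
    using u n by (auto simp: H_ad_def)
  \<comment> \<open>Gives the embedding of L2 into L1 on a probability space. First moments of the
    controls suffice for the cost, since its ingredients grow at most linearly.\<close>
  have "x \<le> 1 + x\<^sup>2" for x :: real
    using self_le_power[of x 2] zero_le_power2[of x] by (smt (verit) pos2)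
  then show "AE \<omega> in M. norm (u n \<omega>) \<le> norm (1 + (norm (u n \<omega>))\<^sup>2)"
    by (auto intro: order_trans)
qed

text \<open>A Lipschitz function grows at most linearly around its value at \<open>0\<close>, and
  constants are integrable on a probability space.\<close>

lemma (in prob_space) integrable_C11:
  fixes f :: "'z::euclidean_space \<Rightarrow> 'y::euclidean_space"
  assumes f: "C11 C f" and Y: "integrable M Y"
  shows "integrable M (\<lambda>\<omega>. f (Y \<omega>))"
proof (rule Bochner_Integration.integrable_bound)
  show "integrable M (\<lambda>\<omega>. norm (f 0) + C * norm (Y \<omega>))"
    using Y by auto
  have "f \<in> borel_measurable borel"
    using C11_continuous[OF f] by (rule borel_measurable_continuous_onI)
  then show "(\<lambda>\<omega>. f (Y \<omega>)) \<in> borel_measurable M"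
    using Y by (auto intro: measurable_compose)
  have "norm (f y) \<le> norm (f 0) + C * norm y" for y
    using C11_lipschitz[OF f, of y 0] norm_triangle_sub[of "f y" "f 0"] by simp
  then show "AE \<omega> in M. norm (f (Y \<omega>)) \<le> norm (norm (f 0) + C * norm (Y \<omega>))"
    by (auto intro!: AE_I2 order_trans[OF _ abs_ge_self])
qed

lemma integrable_Pair:
  fixes f :: "'w \<Rightarrow> 'x::euclidean_space" and g :: "'w \<Rightarrow> 'c::euclidean_space"
  assumes "integrable M f" "integrable M g"
  shows "integrable M (\<lambda>\<omega>. (f \<omega>, g \<omega>))"
proof -
  have "integrable M (\<lambda>\<omega>. (f \<omega>, 0) + (0, g \<omega>) :: 'x \<times> 'c)"
    using assms
    by (intro Bochner_Integration.integrable_add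
        integrable_bounded_linear[where T = "\<lambda>x. (x, 0)"] integrable_bounded_linear[where T = "\<lambda>c. (0, c)"]
        bounded_linear_Pair bounded_linear_ident bounded_linear_zero)
  then show ?thesis by simp
qed


section \<open>Expansion of the expected cost\<close>

text \<open>The moments of the noise make the remainder integrable; the bound on
  \<open>\<sigma>\<close> makes the product of noise and diffusion coefficient integrable.\<close>

locale controlled_process = prob_space M + controlled_recursion N h C b \<sigma> \<Phi> l x0
  for M :: "'w measure" and N :: nat and h C :: real
    and b \<sigma> :: "nat \<Rightarrow> 'x::euclidean_space \<Rightarrow> 'c::euclidean_space \<Rightarrow> 'x"
    and \<Phi> :: "'x \<Rightarrow> real" and l :: "nat \<Rightarrow> 'x \<Rightarrow> 'c \<Rightarrow> real" and x0 :: 'x +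
  fixes \<xi> :: "nat \<Rightarrow> 'w \<Rightarrow> real" and L' :: real
  assumes \<xi>_moments: "finite_moments M (\<xi> n)"
    and \<sigma>_bounded: "n < N \<Longrightarrow> norm (\<sigma> n x c) \<le> L'"
begin

abbreviation "J \<equiv> cost M \<xi> N h b \<sigma> \<Phi> l x0"
abbreviation "g \<equiv> sample_gradient \<xi> N h b \<sigma> \<Phi> l x0"

text \<open>A product of two integrable variables need not be integrable, but boundedness of
  \<open>\<sigma>\<close> dominates the noise term by a multiple of
  \<open>\<bar>\<xi> n \<omega>\<bar>\<close>. The drift is covered by linear growth.\<close>

lemma integrable_state:
  assumes u: "\<And>n. n < N \<Longrightarrow> integrable M (u n)" and "n \<le> N"
  shows "integrable M (\<lambda>\<omega>. st (\<lambda>k. \<xi> k \<omega>) (\<lambda>k. u k \<omega>) n)"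
  using \<open>n \<le> N\<close>
proof (induction n)
  case 0
  then show ?case by simp
next
  case (Suc n)
  have n: "n < N" using Suc by simp
  define X where "X \<omega> = st (\<lambda>k. \<xi> k \<omega>) (\<lambda>k. u k \<omega>) n" for \<omega>
  have Xu: "integrable M (\<lambda>\<omega>. (X \<omega>, u n \<omega>))"
    using Suc n u unfolding X_def by (intro integrable_Pair) auto
  have B: "integrable M (\<lambda>\<omega>. b n (X \<omega>) (u n \<omega>))"
    using integrable_C11[OF C11_b[OF n] Xu] by simp
  have [measurable]: "(\<lambda>\<omega>. \<sigma> n (X \<omega>) (u n \<omega>)) \<in> borel_measurable M" "\<xi> n \<in> borel_measurable M"
    using integrable_C11[OF C11_\<sigma>[OF n] Xu] \<xi>_moments by (auto simp: finite_moments_def)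
  have "integrable M (\<lambda>\<omega>. (sqrt h * \<xi> n \<omega>) *\<^sub>R \<sigma> n (X \<omega>) (u n \<omega>))"
  proof (rule Bochner_Integration.integrable_bound)
    show "integrable M (\<lambda>\<omega>. (sqrt h * L') * \<bar>\<xi> n \<omega>\<bar>)"
      using finite_moments_integrable[OF \<xi>_moments] by auto
    have "norm ((sqrt h * \<xi> n \<omega>) *\<^sub>R \<sigma> n (X \<omega>) (u n \<omega>)) \<le> (sqrt h * L') * \<bar>\<xi> n \<omega>\<bar>" for \<omega>
      using mult_left_mono[OF \<sigma>_bounded[OF n, of "X \<omega>" "u n \<omega>"], of "sqrt h * \<bar>\<xi> n \<omega>\<bar>"] h_pos
      by (simp add: abs_mult mult_ac)
    then show "AE \<omega> in M. norm ((sqrt h * \<xi> n \<omega>) *\<^sub>R \<sigma> n (X \<omega>) (u n \<omega>)) \<le> norm ((sqrt h * L') * \<bar>\<xi> n \<omega>\<bar>)"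
      by (intro AE_I2) (auto intro: order_trans[OF _ abs_ge_self])
  qed measurable
  then show ?case
    using B Suc n unfolding X_def by simp
qed

lemma integrable_path_cost:
  assumes u: "\<And>n. n < N \<Longrightarrow> integrable M (u n)"
  shows "integrable M (\<lambda>\<omega>. pc (\<lambda>k. \<xi> k \<omega>) (\<lambda>k. u k \<omega>))"
proof -
  have "integrable M (\<lambda>\<omega>. l n (st (\<lambda>k. \<xi> k \<omega>) (\<lambda>k. u k \<omega>) n) (u n \<omega>))" if n: "n < N" for n
    using integrable_C11[OF C11_l[OF n] integrable_Pair[OF integrable_state[OF u] u]] n by simp
  moreover have "integrable M (\<lambda>\<omega>. \<Phi> (st (\<lambda>k. \<xi> k \<omega>) (\<lambda>k. u k \<omega>) N))"
    by (rule integrable_C11[OF C11_\<Phi> integrable_state[OF u]]) auto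
  ultimately show ?thesis unfolding path_cost_def
    by (intro Bochner_Integration.integrable_add integrable_mult_right Bochner_Integration.integrable_sum) auto
qed

text \<open>Depends on \<open>\<omega>\<close> through the noise alone, so that one expectation
  serves all controls and perturbations.\<close>

definition remainder_bound :: "'w \<Rightarrow> real" where
  "remainder_bound \<omega> = (N + 1) * (C + 1) * growth (\<lambda>k. \<xi> k \<omega>) ^ (2 * N)"

lemma remainder_bound_nonneg: "0 \<le> remainder_bound \<omega>"
  using C_nonneg growth_ge(1)[of "\<lambda>k. \<xi> k \<omega>"] by (auto simp: remainder_bound_def)

text \<open>\<open>growth\<close> is affine in the absolute values of the noise, so its moment of
  order \<open>2 * N\<close> is finite.\<close>

lemma integrable_remainder_bound: "integrable M remainder_bound"
proof -
  have "finite_moments M (\<lambda>\<omega>. growth (\<lambda>k. \<xi> k \<omega>))"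
    unfolding growth_def
    by (intro finite_moments_add finite_moments_cmult finite_moments_const finite_moments_sum
        finite_moments_abs \<xi>_moments)
  moreover have "\<bar>growth z\<bar> = growth z" for z
    using growth_ge(1)[of z] by simp
  ultimately show ?thesis
    unfolding remainder_bound_def finite_moments_def by auto
qed

lemma sample_gradient_expansion:
  "\<bar>pc (\<lambda>k. \<xi> k \<omega>) (\<lambda>k. u k \<omega> + v k \<omega>) - pc (\<lambda>k. \<xi> k \<omega>) (\<lambda>k. u k \<omega>)
      - h * (\<Sum>n<N. g u n \<omega> \<bullet> v n \<omega>)\<bar>
    \<le> remainder_bound \<omega> * (\<Sum>k<N. norm (v k \<omega>))\<^sup>2"
  using path_cost_expansion[of "\<lambda>k. \<xi> k \<omega>" "\<lambda>k. u k \<omega>" "\<lambda>k. v k \<omega>"]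
  by (simp add: remainder_bound_def sample_gradient_def)

text \<open>Measurability is inherited from the difference quotients of the cost, so that none has to be
  shown for the derivatives, adjoints and gradients that make up \<open>g\<close>.\<close>

lemma borel_measurable_sample_gradient_inner:
  assumes u: "\<And>n. n < N \<Longrightarrow> integrable M (u n)" and v: "\<And>n. n < N \<Longrightarrow> integrable M (v n)"
  shows "(\<lambda>\<omega>. h * (\<Sum>n<N. g u n \<omega> \<bullet> v n \<omega>)) \<in> borel_measurable M"
proof (rule borel_measurable_LIMSEQ_real)
  define t where "t j = inverse (real (Suc j))" for j
  define q where "q j \<omega> = (pc (\<lambda>k. \<xi> k \<omega>) (\<lambda>k. u k \<omega> + t j *\<^sub>R v k \<omega>)
      - pc (\<lambda>k. \<xi> k \<omega>) (\<lambda>k. u k \<omega>)) / t j" for j \<omega>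
  have t0: "0 < t j" for j by (simp add: t_def)
  show "q j \<in> borel_measurable M" for j
    unfolding q_def
    by (intro borel_measurable_divide borel_measurable_diff borel_measurable_integrable
        integrable_path_cost) (use u v in auto)
  fix \<omega> assume "\<omega> \<in> space M"
  define d where "d = h * (\<Sum>n<N. g u n \<omega> \<bullet> v n \<omega>)"
  define R where "R = remainder_bound \<omega> * (\<Sum>k<N. norm (v k \<omega>))\<^sup>2"
  \<comment> \<open>The remainder is quadratic in the scaled perturbation, so one factor
    \<open>t j\<close> survives the division by \<open>t j\<close>.\<close>
  have "norm (q j \<omega> - d) \<le> R * t j" for j
  proof -
    have V: "(\<Sum>k<N. norm (t j *\<^sub>R v k \<omega>)) = t j * (\<Sum>k<N. norm (v k \<omega>))"
      using t0[of j] by (simp add: sum_distrib_left)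
    have D: "h * (\<Sum>n<N. g u n \<omega> \<bullet> (t j *\<^sub>R v n \<omega>)) = t j * d"
      by (simp add: d_def sum_distrib_left mult_ac)
    have q: "pc (\<lambda>k. \<xi> k \<omega>) (\<lambda>k. u k \<omega> + t j *\<^sub>R v k \<omega>) - pc (\<lambda>k. \<xi> k \<omega>) (\<lambda>k. u k \<omega>)
        = t j * q j \<omega>"
      using t0[of j] by (simp add: q_def)
    have "t j * \<bar>q j \<omega> - d\<bar> = \<bar>t j * q j \<omega> - t j * d\<bar>"
      using t0[of j] by (simp add: right_diff_distrib[symmetric] abs_mult)
    also have "\<dots> \<le> t j * (R * t j)"
      using sample_gradient_expansion[of \<omega> u "\<lambda>k \<omega>. t j *\<^sub>R v k \<omega>"]
      unfolding V D q R_def by (simp add: power_mult_distrib power2_eq_square mult_ac)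
    finally have "t j * \<bar>q j \<omega> - d\<bar> \<le> t j * (R * t j)" .
    then show ?thesis using t0[of j] by simp
  qed
  moreover have "(\<lambda>j. R * t j) \<longlonglongrightarrow> 0"
    unfolding t_def using tendsto_mult_right_zero[OF LIMSEQ_inverse_real_of_nat] .
  ultimately have "(\<lambda>j. q j \<omega> - d) \<longlonglongrightarrow> 0"
    by (intro Lim_null_comparison[of "\<lambda>j. q j \<omega> - d" "\<lambda>j. R * t j"]) auto
  then show "(\<lambda>j. q j \<omega>) \<longlonglongrightarrow> h * (\<Sum>n<N. g u n \<omega> \<bullet> v n \<omega>)"
    unfolding d_def by (rule LIM_zero_cancel)
qed

text \<open>The first-order term is the cost difference minus the remainder. The former is
  integrable and the latter is dominated by \<open>remainder_bound \<omega> * c\<^sup>2\<close>, so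
  integrability follows without estimating \<open>g\<close>; taking expectations gives the
  expansion.\<close>

lemma
  assumes u: "\<And>n. n < N \<Longrightarrow> integrable M (u n)" and v: "\<And>n. n < N \<Longrightarrow> integrable M (v n)"
    and V: "AE \<omega> in M. (\<Sum>k<N. norm (v k \<omega>)) \<le> c"
  shows integrable_sample_gradient_inner: "integrable M (\<lambda>\<omega>. h * (\<Sum>n<N. g u n \<omega> \<bullet> v n \<omega>))"
    and cost_expansion: "\<bar>J (\<lambda>n \<omega>. u n \<omega> + v n \<omega>) - J u
      - integral\<^sup>L M (\<lambda>\<omega>. h * (\<Sum>n<N. g u n \<omega> \<bullet> v n \<omega>))\<bar> \<le> expectation remainder_bound * c\<^sup>2"
proof -
  define f where "f \<omega> = pc (\<lambda>k. \<xi> k \<omega>) (\<lambda>k. u k \<omega>)" for \<omega>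
  define f' where "f' \<omega> = pc (\<lambda>k. \<xi> k \<omega>) (\<lambda>k. u k \<omega> + v k \<omega>)" for \<omega>
  define d where "d \<omega> = h * (\<Sum>n<N. g u n \<omega> \<bullet> v n \<omega>)" for \<omega>
  have f: "integrable M f" "integrable M f'"
    unfolding f_def f'_def by (intro integrable_path_cost; use u v in auto)+
  have Rc: "integrable M (\<lambda>\<omega>. remainder_bound \<omega> * c\<^sup>2)"
    using integrable_remainder_bound by simp
  have bound: "AE \<omega> in M. \<bar>f' \<omega> - f \<omega> - d \<omega>\<bar> \<le> remainder_bound \<omega> * c\<^sup>2"
    using V
  proof eventually_elim
    case (elim \<omega>)
    have "\<bar>f' \<omega> - f \<omega> - d \<omega>\<bar> \<le> remainder_bound \<omega> * (\<Sum>k<N. norm (v k \<omega>))\<^sup>2"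
      unfolding f_def f'_def d_def by (rule sample_gradient_expansion)
    also have "\<dots> \<le> remainder_bound \<omega> * c\<^sup>2"
      using elim remainder_bound_nonneg by (intro mult_left_mono power_mono) (auto intro: sum_nonneg)
    finally show ?case .
  qed
  have [measurable]: "d \<in> borel_measurable M"
    unfolding d_def by (rule borel_measurable_sample_gradient_inner[OF u v])
  have [measurable]: "f \<in> borel_measurable M" "f' \<in> borel_measurable M"
    using f by auto
  have r: "integrable M (\<lambda>\<omega>. f' \<omega> - f \<omega> - d \<omega>)"
    by (rule Bochner_Integration.integrable_bound[OF Rc]) (measurable, use bound in \<open>auto intro: order_trans\<close>)
  have d: "integrable M d"
    using Bochner_Integration.integrable_diff[OF Bochner_Integration.integrable_diff[OF f(2) f(1)] r]
    by simp
  then show "integrable M (\<lambda>\<omega>. h * (\<Sum>n<N. g u n \<omega> \<bullet> v n \<omega>))" by (simp add: d_def[abs_def])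
  have "J (\<lambda>n \<omega>. u n \<omega> + v n \<omega>) - J u - integral\<^sup>L M d = expectation (\<lambda>\<omega>. f' \<omega> - f \<omega> - d \<omega>)"
    using f d by (simp add: cost_def f_def[abs_def] f'_def[abs_def])
  also have "\<bar>\<dots>\<bar> \<le> expectation (\<lambda>\<omega>. \<bar>f' \<omega> - f \<omega> - d \<omega>\<bar>)"
    by (rule integral_abs_bound)
  also have "\<dots> \<le> expectation (\<lambda>\<omega>. remainder_bound \<omega> * c\<^sup>2)"
    using r Rc bound by (intro integral_mono_AE) auto
  finally show "\<bar>J (\<lambda>n \<omega>. u n \<omega> + v n \<omega>) - J u
      - integral\<^sup>L M (\<lambda>\<omega>. h * (\<Sum>n<N. g u n \<omega> \<bullet> v n \<omega>))\<bar> \<le> expectation remainder_bound * c\<^sup>2"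
    by (simp add: d_def[abs_def])
qed

text \<open>\<open>cost_expansion\<close> is applied to \<open>\<epsilon> *\<^sub>R v\<close>, whose
  size is at most \<open>\<bar>\<epsilon>\<bar> * (N * c)\<close> almost surely. The difference
  quotient then deviates from the claimed derivative by at most
  \<open>Q * \<bar>\<epsilon>\<bar>\<close>, for either sign of \<open>\<epsilon>\<close>.\<close>

lemma cost_has_directional_derivative:
  assumes u: "\<And>n. n < N \<Longrightarrow> integrable M (u n)" and v: "\<And>n. n < N \<Longrightarrow> integrable M (v n)"
    and "bounded_control M N v"
  shows "integrable M (\<lambda>\<omega>. h * (\<Sum>n<N. g u n \<omega> \<bullet> v n \<omega>))"
    and "((\<lambda>\<epsilon>. J (\<lambda>n \<omega>. u n \<omega> + \<epsilon> *\<^sub>R v n \<omega>)) has_real_derivative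
       integral\<^sup>L M (\<lambda>\<omega>. h * (\<Sum>n<N. g u n \<omega> \<bullet> v n \<omega>))) (at 0)"
proof -
  obtain c where "\<forall>n<N. AE \<omega> in M. norm (v n \<omega>) \<le> c"
    using assms(3) unfolding bounded_control_def by blast
  then have "AE \<omega> in M. \<forall>n\<in>{..<N}. norm (v n \<omega>) \<le> c"
    by (intro AE_finite_allI) auto
  then have V: "AE \<omega> in M. (\<Sum>k<N. norm (v k \<omega>)) \<le> N * c"
    by eventually_elim (use sum_bounded_above[of "{..<N}" _ c] in auto)
  show "integrable M (\<lambda>\<omega>. h * (\<Sum>n<N. g u n \<omega> \<bullet> v n \<omega>))"
    by (rule integrable_sample_gradient_inner[OF u v V])
  define d where "d = integral\<^sup>L M (\<lambda>\<omega>. h * (\<Sum>n<N. g u n \<omega> \<bullet> v n \<omega>))"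
  define f where "f \<epsilon> = J (\<lambda>n \<omega>. u n \<omega> + \<epsilon> *\<^sub>R v n \<omega>)" for \<epsilon>
  define Q where "Q = expectation remainder_bound * (N * c)\<^sup>2"
  have Q: "\<bar>f \<epsilon> - f 0 - \<epsilon> * d\<bar> \<le> Q * \<epsilon>\<^sup>2" for \<epsilon>
  proof -
    have "AE \<omega> in M. (\<Sum>k<N. norm (\<epsilon> *\<^sub>R v k \<omega>)) \<le> \<bar>\<epsilon>\<bar> * (N * c)"
      using V by eventually_elim (simp add: sum_distrib_left[symmetric] mult_left_mono)
    from cost_expansion[of u "\<lambda>n \<omega>. \<epsilon> *\<^sub>R v n \<omega>", OF u _ this] v
    have "\<bar>f \<epsilon> - f 0 - integral\<^sup>L M (\<lambda>\<omega>. h * (\<Sum>n<N. g u n \<omega> \<bullet> (\<epsilon> *\<^sub>R v n \<omega>)))\<bar>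
        \<le> expectation remainder_bound * (\<bar>\<epsilon>\<bar> * (N * c))\<^sup>2"
      by (simp add: f_def)
    also have "(\<lambda>\<omega>. h * (\<Sum>n<N. g u n \<omega> \<bullet> (\<epsilon> *\<^sub>R v n \<omega>)))
        = (\<lambda>\<omega>. \<epsilon> * (h * (\<Sum>n<N. g u n \<omega> \<bullet> v n \<omega>)))"
      by (simp add: sum_distrib_left mult_ac)
    finally show ?thesis by (simp add: d_def Q_def power_mult_distrib mult_ac)
  qed
  have "((\<lambda>\<epsilon>. Q * \<bar>\<epsilon>\<bar>) \<longlongrightarrow> 0) (at 0)"
    by (auto intro!: tendsto_eq_intros)
  moreover have "\<forall>\<^sub>F \<epsilon> in at 0. norm ((f (0 + \<epsilon>) - f 0) / \<epsilon> - d) \<le> Q * \<bar>\<epsilon>\<bar>"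
    unfolding eventually_at_filter
  proof (intro always_eventually allI impI)
    fix \<epsilon> :: real assume "\<epsilon> \<noteq> 0"
    then have "(f (0 + \<epsilon>) - f 0) / \<epsilon> - d = (f \<epsilon> - f 0 - \<epsilon> * d) / \<epsilon>"
      by (simp add: field_simps)
    also have "norm \<dots> \<le> Q * \<epsilon>\<^sup>2 / \<bar>\<epsilon>\<bar>"
      using Q[of \<epsilon>] by (simp add: divide_right_mono)
    also have "\<dots> = Q * \<bar>\<epsilon>\<bar>"
      using \<open>\<epsilon> \<noteq> 0\<close> by (simp add: power2_eq_square divide_simps)
    finally show "norm ((f (0 + \<epsilon>) - f 0) / \<epsilon> - d) \<le> Q * \<bar>\<epsilon>\<bar>" .
  qed
  ultimately have "((\<lambda>\<epsilon>. (f (0 + \<epsilon>) - f 0) / \<epsilon> - d) \<longlongrightarrow> 0) (at 0)"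
    by (rule Lim_null_comparison[rotated])
  then show "((\<lambda>\<epsilon>. J (\<lambda>n \<omega>. u n \<omega> + \<epsilon> *\<^sub>R v n \<omega>)) has_real_derivative d) (at 0)"
    unfolding f_def[symmetric] DERIV_def by (rule LIM_zero_cancel)
qed

section \<open>The gradient at deterministic controls\<close>

lemma integrable_sample_gradient:
  fixes u :: "nat \<Rightarrow> 'c"
  assumes n: "n < N"
  shows "integrable M (g (\<lambda>n \<omega>. u n) n)"
proof -
  let ?g = "g (\<lambda>n \<omega>. u n)"
  have "integrable M (\<lambda>\<omega>. ?g n \<omega> \<bullet> i)" for i
  proof -
    \<comment> \<open>A deterministic perturbation at the single time \<open>n\<close> in direction
      \<open>i\<close> isolates one component of the gradient, which thereby inherits measurability
      and integrability from the pairing.\<close>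
    let ?v = "\<lambda>k \<omega>::'w. if k = n then i else 0"
    have "integrable M (\<lambda>\<omega>. h * (\<Sum>k<N. ?g k \<omega> \<bullet> ?v k \<omega>))"
      \<comment> \<open>\<open>?v\<close> is constant in its second argument, so evaluating it at
        \<open>undefined\<close> still gives a valid bound.\<close>
      by (rule integrable_sample_gradient_inner[where c = "\<Sum>k<N. norm (?v k undefined)"]) auto
    moreover have "(\<Sum>k<N. ?g k \<omega> \<bullet> ?v k \<omega>) = ?g n \<omega> \<bullet> i" for \<omega>
      using n by (subst sum.remove[of _ n]) (auto intro!: sum.neutral)
    ultimately show ?thesis using h_pos by simp
  qed
  then have "integrable M (\<lambda>\<omega>. \<Sum>i\<in>Basis. (?g n \<omega> \<bullet> i) *\<^sub>R i)"
    by auto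
  then show ?thesis by (simp add: euclidean_representation)
qed

text \<open>Converts the sum of norms in the remainder into the weighted Hilbert norm: each single
  term satisfies \<open>sqrt h * norm (v k) \<le> hdet_norm h N v\<close>.\<close>

lemma sum_norm_le_hdet_norm:
  fixes v :: "nat \<Rightarrow> 'c"
  shows "(\<Sum>k<N. norm (v k)) \<le> N / sqrt h * hdet_norm h N v"
proof -
  have "norm (v k) \<le> hdet_norm h N v / sqrt h" if "k < N" for k
  proof -
    have "h * (v k \<bullet> v k) \<le> hdet_inner h N v v"
      unfolding hdet_inner_def using that h_pos member_le_sum[of k "{..<N}" "\<lambda>k. v k \<bullet> v k"] by auto
    then have "sqrt h * norm (v k) \<le> hdet_norm h N v"
      unfolding hdet_norm_def norm_eq_sqrt_inner real_sqrt_mult[symmetric] by simp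
    then show ?thesis using h_pos by (simp add: field_simps)
  qed
  then have "(\<Sum>k<N. norm (v k)) \<le> (\<Sum>k<N. hdet_norm h N v / sqrt h)"
    by (intro sum_mono) auto
  then show ?thesis by simp
qed

text \<open>For deterministic \<open>v\<close> the expectation passes inside the pairing, so the
  linear term is the weighted inner product with the expected gradient. By
  \<open>sum_norm_le_hdet_norm\<close> the remainder is at most \<open>Q\<close> times the squared
  weighted norm.\<close>

lemma has_hdet_gradient_cost:
  fixes u :: "nat \<Rightarrow> 'c"
  shows "has_hdet_gradient h N (\<lambda>w. J (\<lambda>n \<omega>. w n)) u (\<lambda>n. integral\<^sup>L M (g (\<lambda>n \<omega>. u n) n))"
  unfolding has_hdet_gradient_def
proof (intro allI impI)
  let ?g = "g (\<lambda>n \<omega>. u n)"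
  define Q where "Q = expectation remainder_bound * (N / sqrt h)\<^sup>2"
  have Q0: "0 \<le> Q"
    unfolding Q_def using remainder_bound_nonneg by (intro mult_nonneg_nonneg integral_nonneg_AE) auto
  fix e :: real assume e: "0 < e"
  show "\<exists>d>0. \<forall>v. hdet_norm h N v < d \<longrightarrow>
      \<bar>J (\<lambda>n \<omega>. u n + v n) - J (\<lambda>n \<omega>. u n) - hdet_inner h N (\<lambda>n. integral\<^sup>L M (?g n)) v\<bar>
        \<le> e * hdet_norm h N v"
  \<comment> \<open>The radius divides by \<open>Q + 1\<close> because \<open>Q\<close> is only
    known to be nonnegative.\<close>
  proof (intro exI[of _ "e / (Q + 1)"] conjI allI impI)
    show "0 < e / (Q + 1)" using e Q0 by simp
    fix v :: "nat \<Rightarrow> 'c" assume v: "hdet_norm h N v < e / (Q + 1)"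
    have r0: "0 \<le> hdet_norm h N v"
      using h_pos by (auto simp: hdet_norm_def hdet_inner_def intro!: mult_nonneg_nonneg sum_nonneg)
    have "Q * hdet_norm h N v \<le> (Q + 1) * hdet_norm h N v"
      using r0 by (intro mult_right_mono) auto
    also have "\<dots> \<le> e"
      using v Q0 by (simp add: field_simps)
    finally have Qe: "Q * hdet_norm h N v \<le> e" .
    have "integral\<^sup>L M (\<lambda>\<omega>. h * (\<Sum>n<N. ?g n \<omega> \<bullet> v n)) = hdet_inner h N (\<lambda>n. integral\<^sup>L M (?g n)) v"
      using integrable_sample_gradient by (simp add: hdet_inner_def integral_sum)
    then have "\<bar>J (\<lambda>n \<omega>. u n + v n) - J (\<lambda>n \<omega>. u n) - hdet_inner h N (\<lambda>n. integral\<^sup>L M (?g n)) v\<bar>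
        \<le> expectation remainder_bound * (N / sqrt h * hdet_norm h N v)\<^sup>2"
      using cost_expansion[of "\<lambda>n \<omega>. u n" "\<lambda>n \<omega>. v n" "N / sqrt h * hdet_norm h N v"]
        sum_norm_le_hdet_norm[of v] by simp
    also have "\<dots> = (Q * hdet_norm h N v) * hdet_norm h N v"
      unfolding Q_def power_mult_distrib by (simp add: power2_eq_square)
    also have "\<dots> \<le> e * hdet_norm h N v"
      using Qe r0 by (rule mult_right_mono)
    finally show "\<bar>J (\<lambda>n \<omega>. u n + v n) - J (\<lambda>n \<omega>. u n) - hdet_inner h N (\<lambda>n. integral\<^sup>L M (?g n)) v\<bar>
        \<le> e * hdet_norm h N v" .
  qed
qed

end


text \<open>The integrability claims accompany the identities because a Bochner integral of a
  non-integrable function is 0 by convention; they certify that the integrals are genuine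
  expectations.\<close>

theorem theorem14:
  fixes M :: "'w measure" and B :: "real \<Rightarrow> 'w \<Rightarrow> real"
    and H h L K L' :: real and N :: nat
    and \<beta> \<gamma> :: "nat \<Rightarrow> nat \<Rightarrow> real" and \<xi> \<eta> :: "nat \<Rightarrow> 'w \<Rightarrow> real" and F :: "nat \<Rightarrow> 'w measure"
    and x0 :: "real ^ 'd"
    and b \<sigma> :: "nat \<Rightarrow> real ^ 'd \<Rightarrow> real ^ 'p \<Rightarrow> real ^ 'd"
    and \<Phi> :: "real ^ 'd \<Rightarrow> real"
    and l :: "nat \<Rightarrow> real ^ 'd \<Rightarrow> real ^ 'p \<Rightarrow> real"
    and U :: "(real ^ 'p) set"
    and J :: "(nat \<Rightarrow> 'w \<Rightarrow> real ^ 'p) \<Rightarrow> real"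
    and g :: "(nat \<Rightarrow> 'w \<Rightarrow> real ^ 'p) \<Rightarrow> nat \<Rightarrow> 'w \<Rightarrow> real ^ 'p"
  assumes "prob_space M" and "complete_measure M"
    and "0 < H" and "H < 1" and "1 \<le> N" and "0 < h"
    and "fractional_brownian_motion M H B"
    and "cholesky_factor N (fgn_cov H) \<beta>" and "inverse_matrix N \<beta> \<gamma>"
    and xi_def: "\<xi> = fgn H h B"
    and eta_def: "\<eta> = innovation \<gamma> \<xi>"
    and F_def: "F = innovation_filtration M \<eta>"
    and J_def: "J = cost M \<xi> N h b \<sigma> \<Phi> l x0"
    and g_def: "g = sample_gradient \<xi> N h b \<sigma> \<Phi> l x0"
    and A1: "0 < L" "C2_bounded_lipschitz L K \<Phi>"
      "\<forall>n<N. C2_bounded_lipschitz L K (\<lambda>(x, c). b n x c) \<and>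
             C2_bounded_lipschitz L K (\<lambda>(x, c). \<sigma> n x c) \<and>
             C2_bounded_lipschitz L K (\<lambda>(x, c). l n x c)"
    and A2: "0 < L'"
      "\<forall>n<N. \<forall>x c. norm (b n x c) \<le> L' * (1 + norm x + norm c) \<and> norm (\<sigma> n x c) \<le> L'"
    and A3: "closed U" "convex U" "0 \<in> U"
  shows
    "(\<forall>u \<in> H_ad M F N.
        integrable M (\<lambda>\<omega>. path_cost N h b \<sigma> \<Phi> l x0 (\<lambda>n. \<xi> n \<omega>) (\<lambda>n. u n \<omega>)))
     \<and> (\<forall>u \<in> H_ad M F N. \<forall>v \<in> H_ad M F N. bounded_control M N v \<longrightarrow>
          integrable M (\<lambda>\<omega>. h * (\<Sum>n<N. g u n \<omega> \<bullet> v n \<omega>)) \<and>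
          ((\<lambda>\<epsilon>. J (\<lambda>n \<omega>. u n \<omega> + \<epsilon> *\<^sub>R v n \<omega>)) has_real_derivative
             integral\<^sup>L M (\<lambda>\<omega>. h * (\<Sum>n<N. g u n \<omega> \<bullet> v n \<omega>))) (at 0))
     \<and> (\<forall>u :: nat \<Rightarrow> real ^ 'p.
          (\<forall>n<N. integrable M (g (\<lambda>n \<omega>. u n) n)) \<and>
          has_hdet_gradient h N (\<lambda>w. J (\<lambda>n \<omega>. w n)) u
            (\<lambda>n. integral\<^sup>L M (g (\<lambda>n \<omega>. u n) n)))"
proof (intro conjI ballI allI impI)
  interpret prob_space M by fact
  \<comment> \<open>One constant for all coefficients: the product space has the largest dimension
    among the domains, and \<open>max L K\<close> covers both the bound and the Lipschitz constant
    of the derivatives.\<close>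
  define C where "C = DIM((real^'d) \<times> (real^'p)) * max L K"
  have C: "C11 C f" if "C2_bounded_lipschitz L K f" "DIM('z) \<le> DIM((real^'d) \<times> (real^'p))"
    for f :: "'z::euclidean_space \<Rightarrow> 'y::euclidean_space"
  proof (rule C2_bounded_lipschitz_imp_C11[OF that(1)])
    have "real DIM('z) * m \<le> C" if "m \<le> max L K" for m
    proof -
      have "real DIM('z) * m \<le> real DIM('z) * max L K"
        using that by (intro mult_left_mono) auto
      also have "\<dots> \<le> C"
        unfolding C_def using A1(1) \<open>DIM('z) \<le> _\<close> by (intro mult_right_mono) auto
      finally show ?thesis .
    qed
    then show "real DIM('z) * L \<le> C" "real DIM('z) * K \<le> C" by auto
  qed
  interpret controlled_process M N h C b \<sigma> \<Phi> l x0 \<xi> L'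
  proof unfold_locales
    show "C11 C \<Phi>" by (rule C[OF A1(2)]) simp
    show "finite_moments M (\<xi> n)" for n
      unfolding xi_def by (rule fgn_finite_moments) fact+
  qed (use A1(3) A2(2) \<open>0 < h\<close> in \<open>auto intro!: C simp del: DIM_prod\<close>)
  have "\<xi> k \<in> borel_measurable M" for k
    using \<xi>_moments by (simp add: finite_moments_def)
  then have ad: "integrable M (u n)" if "u \<in> H_ad M F N" "n < N" for u :: "nat \<Rightarrow> 'w \<Rightarrow> real ^ 'p" and n
    using H_ad_integrable[OF \<open>prob_space M\<close>, of \<xi> u \<gamma> N n] that by (simp add: F_def eta_def)
  show "integrable M (\<lambda>\<omega>. path_cost N h b \<sigma> \<Phi> l x0 (\<lambda>n. \<xi> n \<omega>) (\<lambda>n. u n \<omega>))"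
    if "u \<in> H_ad M F N" for u
    using ad[OF that] by (rule integrable_path_cost)
  show "integrable M (\<lambda>\<omega>. h * (\<Sum>n<N. g u n \<omega> \<bullet> v n \<omega>))"
    "((\<lambda>\<epsilon>. J (\<lambda>n \<omega>. u n \<omega> + \<epsilon> *\<^sub>R v n \<omega>)) has_real_derivative
       integral\<^sup>L M (\<lambda>\<omega>. h * (\<Sum>n<N. g u n \<omega> \<bullet> v n \<omega>))) (at 0)"
    if "u \<in> H_ad M F N" "v \<in> H_ad M F N" "bounded_control M N v" for u v
    unfolding J_def g_def
    using cost_has_directional_derivative[OF ad[OF that(1)] ad[OF that(2)] that(3)] by simp_all
  show "integrable M (g (\<lambda>n \<omega>. u n) n)" if "n < N" for u :: "nat \<Rightarrow> real ^ 'p" and n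
    unfolding g_def by (rule integrable_sample_gradient[OF that])
  show "has_hdet_gradient h N (\<lambda>w. J (\<lambda>n \<omega>. w n)) u (\<lambda>n. integral\<^sup>L M (g (\<lambda>n \<omega>. u n) n))"
    for u :: "nat \<Rightarrow> real ^ 'p"
    unfolding J_def g_def by (rule has_hdet_gradient_cost)
qed

end
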